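(* Let $\Lambda$ be a cyclic Nakayama algebra. Then the Euler characteristic $\chi(L(\Lambda))$ of its relation complex $L(\Lambda)$ is equal to the number of connected components of its resolution quiver $R(\Lambda)$ which have weight $1$.
   Context: Let $K$ be a field. For $n\ge 1$ let $Q_n$ be the quiver with vertices $1,\dots,n$ and arrows $x_i:i\to i+1$ (indices modulo $n$, so $x_n:n\to 1$); paths are written left to right. A Nakayama algebra of order $n$ is an algebra $\Lambda=KQ_n/I$, where $I$ is the two-sided ideal generated by paths (relations) $y_1,\dots,y_r$, $r\ge1$, of length $\ge 1$, chosen irredundant (no $y_i$ is a subword of another $y_j$). It is finite dimensional. It is called a cyclic Nakayama algebra if all the relations $y_i$ have length $\ge 2$. Modules are finitely generated right modules. $S_i$ is the simple module at vertex $i$, $P_i=e_i\Lambda$ is its projective cover, and $|M|$ is the length of $M$. Each $P_i$ is uniserial with composition factors, from the top, $S_i,S_{i+1},S_{i+2},\dots$ (indices modulo $n$). Resolution quiver: $R(\Lambda)$ has vertices $1,\dots,n$ and, for each $i$, exactly one arrow $i\to j$, where $j$ is determined by $\mathrm{soc}\,P_i= S_{j-1}$, i.e. $j\equiv i+|P_i| \pmod n$. Each connected component of $R(\Lambda)$ contains exactly one oriented cycle. The weight of an oriented cycle is $\frac1n\sum_i |P_i|$, the sum being over the vertices $i$ of the cycle, and the weight of a component is the weight of its unique oriented cycle. Relation complex: an internal vertex of a relation is a vertex $i$ such that $x_{i-1}x_i$ (indices modulo $n$) is a subword of the relation; the relation is said to cover its internal vertices. $L(\Lambda)$ is the (possibly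 empty) simplicial complex having one vertex for each relation $y_i$ of length $\le n$, where a nonempty set of such relations spans a simplex if and only if these relations together do not cover all $n$ vertices of $Q_n$. *)

theory Defs
  imports Complex_Main "HOL-Algebra.QuotRing" "HOL-Algebra.Module" "HOL-Algebra.Generated_Groups"
    "HOL-Library.Sublist"
begin

section \<open>Paths in the cyclic quiver\<close>

text \<open>
  The quiver with \<open>n\<close> vertices and arrows \<open>x\<^sub>i : i \<rightarrow> i + 1\<close> (indices modulo \<open>n\<close>). Vertices are
  represented by the residues \<open>0, \<dots>, n - 1\<close>, so vertex \<open>n\<close> is called \<open>0\<close> here. There is exactly one
  path of each length starting at each vertex; the pair \<open>(i, l)\<close> stands for the path
  \<open>x\<^sub>i x\<^sub>i\<^sub>+\<^sub>1 \<dots> x\<^sub>i\<^sub>+\<^sub>l\<^sub>-\<^sub>1\<close> of length \<open>l\<close>, written left to right, and \<open>(i, 0)\<close> for the trivial path \<open>e\<^sub>i\<close>.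
\<close>

type_synonym path = "nat \<times> nat"

definition path_word :: "nat \<Rightarrow> path \<Rightarrow> nat list" where
  "path_word n p = map (\<lambda>k. (fst p + k) mod n) [0..<snd p]"

text \<open>Contiguous subwords (the library's \<^const>\<open>sublist\<close>, as opposed to \<^const>\<open>subseq\<close>).\<close>

definition subword :: "nat \<Rightarrow> path \<Rightarrow> path \<Rightarrow> bool" where
  "subword n p q \<longleftrightarrow> sublist (path_word n p) (path_word n q)"

definition nakayama_relations :: "nat \<Rightarrow> path set \<Rightarrow> bool" where
  "nakayama_relations n Y \<longleftrightarrow>
     n \<ge> 1 \<and> finite Y \<and> Y \<noteq> {} \<and>
     (\<forall>y\<in>Y. fst y < n \<and> snd y \<ge> 1) \<and>
     (\<forall>y\<in>Y. \<forall>z\<in>Y. y \<noteq> z \<longrightarrow> \<not> subword n y z)"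

definition cyclic_nakayama_relations :: "nat \<Rightarrow> path set \<Rightarrow> bool" where
  "cyclic_nakayama_relations n Y \<longleftrightarrow> nakayama_relations n Y \<and> (\<forall>y\<in>Y. snd y \<ge> 2)"


section \<open>Path algebra and Nakayama algebra\<close>

text \<open>
  Elements of the path algebra are the finitely supported functions on the set of paths. The ground
  field is an arbitrary type of class \<^class>\<open>field\<close>. The product sums over all factorisations
  \<open>(i, l) = (i, k) \<cdot> (i + k, l - k)\<close>.
\<close>

definition path_algebra :: "nat \<Rightarrow> (path \<Rightarrow> 'k::field) ring" where
  "path_algebra n =
     \<lparr>carrier = {f. finite {p. f p \<noteq> 0} \<and> (\<forall>i l. f (i, l) \<noteq> 0 \<longrightarrow> i < n)},
      mult = (\<lambda>f g (i, l). \<Sum>k\<le>l. f (i, k) * g ((i + k) mod n, l - k)),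
      one = (\<lambda>(i, l). if i < n \<and> l = 0 then 1 else 0),
      zero = (\<lambda>_. 0),
      add = (\<lambda>f g p. f p + g p)\<rparr>"

definition path_elem :: "path \<Rightarrow> path \<Rightarrow> 'k::field" where
  "path_elem p = (\<lambda>q. if q = p then 1 else 0)"

definition relation_ideal :: "nat \<Rightarrow> path set \<Rightarrow> (path \<Rightarrow> 'k::field) set" where
  "relation_ideal n Y = genideal (path_algebra n) (path_elem ` Y)"

definition nakayama_algebra :: "nat \<Rightarrow> path set \<Rightarrow> (path \<Rightarrow> 'k::field) set ring" where
  "nakayama_algebra n Y = path_algebra n Quot relation_ideal n Y"

definition vertex_idempotent :: "nat \<Rightarrow> path set \<Rightarrow> nat \<Rightarrow> (path \<Rightarrow> 'k::field) set" where
  "vertex_idempotent n Y i = relation_ideal n Y +>\<^bsub>path_algebra n\<^esub> path_elem (i, 0)"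


section \<open>Right modules\<close>

text \<open>
  A right module over a (not necessarily commutative) ring \<open>R\<close> is represented by the library's
  module record, where \<open>r \<odot>\<^bsub>M\<^esub> m\<close> is to be read as the right action \<open>m \<cdot> r\<close>. As usual for module
  records, the fields \<^const>\<open>mult\<close> and \<^const>\<open>one\<close> carry no meaning. The library's locale
  \<^locale>\<open>submodule\<close> (additive subgroup closed under the action) does not depend on the side.
\<close>

definition module_iso ::
    "('a, 'r) ring_scheme \<Rightarrow> ('a, 'm, 's) module_scheme \<Rightarrow> ('a, 'p, 't) module_scheme \<Rightarrow> bool" where
  "module_iso R M N \<longleftrightarrow>
     (\<exists>h. bij_betw h (carrier M) (carrier N) \<and>
          (\<forall>x\<in>carrier M. \<forall>y\<in>carrier M. h (x \<oplus>\<^bsub>M\<^esub> y) = h x \<oplus>\<^bsub>N\<^esub> h y) \<and>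
          (\<forall>r\<in>carrier R. \<forall>x\<in>carrier M. h (r \<odot>\<^bsub>M\<^esub> x) = r \<odot>\<^bsub>N\<^esub> h x))"

definition simple_submodule ::
    "('a, 'r) ring_scheme \<Rightarrow> ('a, 'm, 's) module_scheme \<Rightarrow> 'm set \<Rightarrow> bool" where
  "simple_submodule R M S \<longleftrightarrow>
     submodule S R M \<and> S \<noteq> {\<zero>\<^bsub>M\<^esub>} \<and>
     (\<forall>T. submodule T R M \<and> T \<subseteq> S \<longrightarrow> T = {\<zero>\<^bsub>M\<^esub>} \<or> T = S)"

text \<open>The sum of all simple submodules.\<close>

definition socle ::
    "('a, 'r) ring_scheme \<Rightarrow> ('a, 'm, 's) module_scheme \<Rightarrow> ('a, 'm, 's) module_scheme" where
  "socle R M = M\<lparr>carrier := generate (add_monoid M) (\<Union>{S. simple_submodule R M S})\<rparr>"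

text \<open>
  The length is the maximal length \<open>l\<close> of a strict chain \<open>C\<^sub>0 \<subset> \<dots> \<subset> C\<^sub>l\<close> of submodules. It is only used
  for modules of finite length (the supremum of an unbounded set of naturals is meaningless).
\<close>

definition module_length ::
    "('a, 'r) ring_scheme \<Rightarrow> ('a, 'm, 's) module_scheme \<Rightarrow> nat" where
  "module_length R M =
     Sup {l. \<exists>C :: nat \<Rightarrow> 'm set. (\<forall>k\<le>l. submodule (C k) R M) \<and> (\<forall>k<l. C k \<subset> C (Suc k))}"

text \<open>
  The projective module \<open>P\<^sub>i = e\<^sub>i \<Lambda>\<close>, with \<open>\<Lambda>\<close> acting by multiplication on the right. The ground field
  is passed explicitly as a type argument, because it is not determined by the relations.
\<close>

definition projective_module ::
    "'k::field itself \<Rightarrow> nat \<Rightarrow> path set \<Rightarrow> nat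
       \<Rightarrow> ((path \<Rightarrow> 'k) set, (path \<Rightarrow> 'k) set) module" where
  "projective_module K n Y i =
     (let A = nakayama_algebra n Y in
      \<lparr>carrier = {vertex_idempotent n Y i \<otimes>\<^bsub>A\<^esub> a |a. a \<in> carrier A},
       mult = mult A, one = one A, zero = zero A, add = add A,
       smult = (\<lambda>r m. m \<otimes>\<^bsub>A\<^esub> r)\<rparr>)"

text \<open>
  The simple module \<open>S\<^sub>i\<close> at vertex \<open>i\<close> is the ground field, on which \<open>e\<^sub>i\<close> acts as the identity and
  every other path acts as zero. A residue class therefore acts by the common value of the coefficient
  of \<open>e\<^sub>i\<close> in all its members; it is well defined when all relations have length at least \<open>2\<close>.
\<close>

definition simple_module ::
    "'k::field itself \<Rightarrow> nat \<Rightarrow> ((path \<Rightarrow> 'k) set, 'k) module" where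
  "simple_module K i =
     \<lparr>carrier = UNIV, mult = (*), one = 1, zero = 0, add = (+),
      smult = (\<lambda>r m. m * the_elem ((\<lambda>f. f (i, 0)) ` r))\<rparr>"

definition proj_length :: "'k::field itself \<Rightarrow> nat \<Rightarrow> path set \<Rightarrow> nat \<Rightarrow> nat" where
  "proj_length K n Y i =
     module_length (nakayama_algebra n Y :: (path \<Rightarrow> 'k) set ring) (projective_module K n Y i)"


section \<open>The resolution quiver\<close>

text \<open>The vertices are \<open>{..<n}\<close>; there is an arrow \<open>i \<rightarrow> j\<close> iff \<open>soc P\<^sub>i \<cong> S\<^sub>j\<^sub>-\<^sub>1\<close>.\<close>

definition resolution_arrows :: "'k::field itself \<Rightarrow> nat \<Rightarrow> path set \<Rightarrow> nat rel" where
  "resolution_arrows K n Y =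
     {(i, j). i < n \<and> j < n \<and>
        (let A = (nakayama_algebra n Y :: (path \<Rightarrow> 'k) set ring) in
         module_iso A (socle A (projective_module K n Y i)) (simple_module K ((j + n - 1) mod n)))}"

definition quiver_components :: "'v set \<Rightarrow> 'v rel \<Rightarrow> 'v set set" where
  "quiver_components V E = V // (E \<union> E\<inverse>)\<^sup>*"

definition oriented_cycle :: "'v rel \<Rightarrow> 'v list \<Rightarrow> bool" where
  "oriented_cycle E c \<longleftrightarrow>
     c \<noteq> [] \<and> distinct c \<and> (\<forall>k<length c. (c ! k, c ! (Suc k mod length c)) \<in> E)"

definition cycle_weight :: "'k::field itself \<Rightarrow> nat \<Rightarrow> path set \<Rightarrow> nat list \<Rightarrow> rat" where
  "cycle_weight K n Y c = (\<Sum>i\<leftarrow>c. of_nat (proj_length K n Y i)) / of_nat n"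

text \<open>
  A component of the resolution quiver contains exactly one oriented cycle, up to the choice of its
  first vertex, which does not affect the weight.
\<close>

definition component_weight :: "'k::field itself \<Rightarrow> nat \<Rightarrow> path set \<Rightarrow> nat set \<Rightarrow> rat" where
  "component_weight K n Y C =
     cycle_weight K n Y (SOME c. oriented_cycle (resolution_arrows K n Y) c \<and> set c \<subseteq> C)"


section \<open>The relation complex\<close>

definition internal_vertices :: "nat \<Rightarrow> path \<Rightarrow> nat set" where
  "internal_vertices n y = {i. i < n \<and> sublist [(i + n - 1) mod n, i] (path_word n y)}"

text \<open>A simplicial complex is given by the set of its nonempty simplices.\<close>

definition relation_complex :: "nat \<Rightarrow> path set \<Rightarrow> path set set" where
  "relation_complex n Y =
     {\<sigma>. \<sigma> \<noteq> {} \<and> \<sigma> \<subseteq> {y \<in> Y. snd y \<le> n} \<and> (\<Union>y\<in>\<sigma>. internal_vertices n y) \<noteq> {..<n}}"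

definition euler_characteristic :: "'v set set \<Rightarrow> int" where
  "euler_characteristic L = (\<Sum>\<sigma>\<in>L. (- 1) ^ (card \<sigma> - 1))"

end

theory Submission
  imports Defs
begin

text \<open>
  Unroll the cyclic quiver to a line whose integer points map to the vertices modulo \<open>n\<close>. A relation
  becomes a family of intervals, periodic under the shift by \<open>n\<close>. Let \<open>f v\<close> be the first point at which
  a relation starting at or after \<open>v\<close> ends. Then \<open>f\<close> is monotone, \<open>f (v + n) = f v + n\<close> and \<open>v < f v\<close>.

  The map \<open>f\<close> determines both sides of the theorem. A basis of \<open>P\<^sub>i\<close> is given by the paths from \<open>i\<close> that
  contain no relation, and every nonzero submodule consists of the elements supported on the paths of at
  least some length. So \<open>|P\<^sub>i| = f i - i\<close>, the socle sits at vertex \<open>f i - 1\<close>, and the resolution quiver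
  is the graph of \<open>f\<close> modulo \<open>n\<close> (lemmas \<open>P_length\<close> and \<open>socle_iso_simple\<close>). By irredundancy the relations
  start exactly at the points \<open>a\<close> with \<open>f a < f (a + 1)\<close>, and the relation starting at \<open>a\<close> ends at \<open>f a\<close>.
  A relation of length greater than \<open>n\<close> covers every vertex by itself, so it lies in no noncovering set,
  and the simplices of the relation complex are just the nonempty noncovering sets of relations.

  Since all subsets of a nonempty finite set have signed count \<open>0\<close>, the Euler characteristic is \<open>1\<close> plus
  the sum of \<open>(-1)\<close> to the cardinality over the covering sets. A set is covering iff its starting points
  \<open>a\<^sub>1 < \<dots> < a\<^sub>m < a\<^sub>1 + n\<close> satisfy \<open>a\<^sub>k\<^sub>+\<^sub>1 < f a\<^sub>k\<close> for all \<open>k\<close>, including the closing step to \<open>a\<^sub>1 + n\<close>. In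
  other words, it is a closed walk for the step matrix \<open>M\<close> with \<open>M v w = 1\<close> if \<open>v < w < f v\<close>. The key
  identity is \<open>1 + M = (1 - F) Z\<close>, where \<open>Z v w = 1\<close> if \<open>v \<le> w\<close>, and \<open>F\<close> is the matrix of \<open>f\<close>, read as a map
  from starting points to starting points. Inverting gives \<open>Z\<^sup>-\<^sup>1 (1 + F + F\<^sup>2 + \<dots>)\<close>, so the signed number
  of walks from \<open>v\<close> to \<open>u\<close> only compares whether \<open>u\<close> lies on the orbit of \<open>v\<close> and on that of \<open>v + 1\<close> (lemma
  \<open>chain_sum\<close>).

  Summing over the first point of a covering set telescopes. Every possible last point \<open>u\<close> contributes \<open>1\<close>
  if the orbit of \<open>f u\<close> passes through \<open>f u + n\<close>, and \<open>-1\<close> if the orbit of \<open>0\<close> passes through \<open>f u\<close>,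
  where only the points \<open>u\<close> matter at which an orbit leaves a fixed fundamental domain. An orbit
  leaves it exactly once, so the positive terms count the cycles of weight \<open>1\<close>, and the negative ones,
  belonging to a single orbit, add up to \<open>-1\<close> (lemma \<open>covering_sum\<close>). Hence the covering sets contribute
  the number of cycles of weight \<open>1\<close> minus \<open>1\<close>.

  Finally, a cycle of weight \<open>w\<close> through \<open>i\<close> satisfies \<open>f\<^sup>m i = i + w n\<close>, and each component has just one
  cycle, so the cycles of weight \<open>1\<close> correspond to the components of weight \<open>1\<close> (lemma
  \<open>card_weight_one_components\<close>).
\<close>

section \<open>Signed count of the covering sets of a periodic monotone map\<close>

text \<open>
  Lifts to the line of maps from the cycle \<open>\<int>/n\<close> to itself. Natural numbers suffice as the line,
  because \<open>f\<close> only moves points to the right.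
\<close>

locale periodic_map =
  fixes f :: "nat \<Rightarrow> nat" and n :: nat
  assumes n_pos: "0 < n"
    and mono_f: "mono f"
    and shift: "f (v + n) = f v + n"
    and incr: "v < f v"
begin

text \<open>
  The points where \<open>f\<close> increases. For the map of a set of relations these are their starting points, and
  the relation starting at \<open>a\<close> is the interval from \<open>a\<close> to \<open>f a\<close>, with interior \<open>{a<..<f a}\<close>.
\<close>

definition jumps :: "nat set" where
  "jumps = {v. f v < f (Suc v)}"

text \<open>
  The walks from \<open>v\<close> to \<open>u\<close> whose steps lead from \<open>a\<close> to a point below \<open>f a\<close>, stored as the set of their
  points. Asking for some \<open>b\<close> in \<open>S\<close> between \<open>a\<close> and \<open>f a\<close> amounts to asking it of the successor of \<open>a\<close>
  in \<open>S\<close>, which avoids sorting \<open>S\<close>.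
\<close>

definition chains :: "nat \<Rightarrow> nat \<Rightarrow> nat set set" where
  "chains v u = {S. S \<subseteq> jumps \<inter> {v..u} \<and> v \<in> S \<and> u \<in> S \<and>
     (\<forall>a\<in>S. a \<noteq> u \<longrightarrow> (\<exists>b\<in>S. a < b \<and> b < f a))}"

text \<open>
  For a jump \<open>u\<close> this says that \<open>u\<close> lies on the orbit of \<open>v\<close> under the map that sends \<open>w\<close> to the first jump
  at or after \<open>f w\<close>, started at the first jump at or after \<open>v\<close>. It is phrased through the values \<open>f w\<close>
  because \<open>f\<close> does not distinguish \<open>w\<close> from the first jump after it, but is injective on jumps.
\<close>

definition reach :: "nat \<Rightarrow> nat \<Rightarrow> bool" where
  "reach v u \<longleftrightarrow> (\<exists>k. (f ^^ Suc k) v = f u)"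

lemma f_le: "v \<le> w \<Longrightarrow> f v \<le> f w"
  using mono_f by (rule monoD)

lemma jump_less: "u \<in> jumps \<Longrightarrow> u < v \<Longrightarrow> f u < f v"
  unfolding jumps_def using f_le[of "Suc u" v] by auto

lemma inj_on_jumps: "inj_on f jumps"
  by (rule linorder_inj_onI') (metis jump_less less_irrefl)

lemma shift_mult: "f (v + k * n) = f v + k * n"
proof (induction k)
  case (Suc k)
  then show ?case using shift[of "v + k * n"] by (simp add: algebra_simps)
qed simp

lemma funpow_shift: "(f ^^ m) (v + k * n) = (f ^^ m) v + k * n"
  by (induction m) (simp_all add: shift_mult)

lemma funpow_increasing: "v + m \<le> (f ^^ m) v"
proof (induction m)
  case (Suc m)
  then show ?case using incr[of "(f ^^ m) v"] by simp
qed simp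

lemma funpow_strict: "i < j \<Longrightarrow> (f ^^ i) v < (f ^^ j) v"
  by (rule lift_Suc_mono_less[of "\<lambda>i. (f ^^ i) v"]) (simp_all add: incr)

lemma funpow_le: "i \<le> j \<Longrightarrow> (f ^^ i) v \<le> (f ^^ j) v"
  by (metis funpow_strict le_neq_implies_less less_imp_le order_refl)

lemma reach_less:
  assumes "u \<in> jumps" "u < v" shows "\<not> reach v u"
proof
  assume "reach v u"
  then obtain k where "(f ^^ Suc k) v = f u" unfolding reach_def by blast
  moreover have "f v \<le> (f ^^ Suc k) v" using funpow_le[of 1 "Suc k" v] by simp
  ultimately show False using jump_less[OF assms] by simp
qed

lemma reach_step:
  assumes "u \<in> jumps" "v \<in> jumps" "v \<noteq> u"
  shows "reach (f v) u = reach v u"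
proof -
  have ne: "f v \<noteq> f u" using assms inj_on_jumps by (auto dest: inj_onD)
  show ?thesis
  proof
    assume "reach (f v) u"
    then obtain k where "(f ^^ Suc k) (f v) = f u" unfolding reach_def by blast
    then have "(f ^^ Suc (Suc k)) v = f u" by (simp add: funpow_swap1)
    then show "reach v u" unfolding reach_def by blast
  next
    assume "reach v u"
    then obtain k where k: "(f ^^ Suc k) v = f u" unfolding reach_def by blast
    then obtain m where "k = Suc m" using ne by (cases k) auto
    with k have "(f ^^ Suc m) (f v) = f u" by (simp add: funpow_swap1)
    then show "reach (f v) u" unfolding reach_def by blast
  qed
qed

lemma reach_not_jump: "v \<notin> jumps \<Longrightarrow> reach (Suc v) u = reach v u"
proof -
  assume "v \<notin> jumps"
  then have "f (Suc v) = f v" unfolding jumps_def using f_le[of v "Suc v"] by simp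
  then show ?thesis unfolding reach_def by (simp only: funpow_Suc_right o_apply)
qed

lemma chainsD:
  assumes "S \<in> chains v u"
  shows "v \<in> S" "u \<in> S" "x \<in> S \<Longrightarrow> x \<in> jumps" "x \<in> S \<Longrightarrow> v \<le> x" "x \<in> S \<Longrightarrow> x \<le> u"
  using assms by (simp_all add: chains_def) auto

lemma chains_next:
  assumes "S \<in> chains v u" "a \<in> S" "a \<noteq> u"
  obtains b where "b \<in> S" "a < b" "b < f a"
  using assms unfolding chains_def by blast

lemma chainsI:
  assumes "v \<in> S" "u \<in> S" "\<And>x. x \<in> S \<Longrightarrow> x \<in> jumps \<and> v \<le> x \<and> x \<le> u"
    and "\<And>a. a \<in> S \<Longrightarrow> a \<noteq> u \<Longrightarrow> \<exists>b\<in>S. a < b \<and> b < f a"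
  shows "S \<in> chains v u"
  unfolding chains_def using assms by (intro CollectI conjI ballI impI subsetI) simp_all

lemma chains_finite: "finite (chains v u)"
  by (rule finite_subset[of _ "Pow {v..u}"]) (use chainsD in auto)

lemma chains_member_finite: "S \<in> chains v u \<Longrightarrow> finite S"
  by (rule finite_subset[of _ "{v..u}"]) (use chainsD in auto)

lemma chains_Min: "S \<in> chains v u \<Longrightarrow> Min S = v"
  by (rule Min_eqI[OF chains_member_finite]) (use chainsD in auto)

lemma chains_Max: "S \<in> chains v u \<Longrightarrow> Max S = u"
  by (rule Max_eqI[OF chains_member_finite]) (use chainsD in auto)

text \<open>
  A chain from \<open>v\<close> is \<open>v\<close> followed by a chain from its second point \<open>w\<close>; this is the recursion that inverts
  the step matrix.
\<close>

lemma chains_step: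
  assumes "v \<in> jumps" "v < u"
  shows "chains v u = (\<Union>w\<in>jumps \<inter> {v<..<f v}. insert v ` chains w u)"
proof (intro equalityI subsetI)
  fix S assume S: "S \<in> chains v u"
  have fin: "finite S" using S by (rule chains_member_finite)
  let ?T = "S - {v}"
  have u: "u \<in> ?T" using chainsD(2)[OF S] assms by simp
  define w where "w = Min ?T"
  have wT: "w \<in> ?T" unfolding w_def using fin u by (intro Min_in) auto
  have wle: "w \<le> x" if "x \<in> ?T" for x unfolding w_def using fin that by simp
  obtain b where b: "b \<in> S" "v < b" "b < f v"
    using chains_next[OF S chainsD(1)[OF S]] assms(2) by blast
  with wle[of b] have "w < f v" by simp
  moreover have "v < w" "w \<in> jumps" using wT chainsD(3,4)[OF S, of w] by simp_all
  moreover have "?T \<in> chains w u"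
  proof (rule chainsI)
    show "x \<in> jumps \<and> w \<le> x \<and> x \<le> u" if "x \<in> ?T" for x
      using that wle[OF that] chainsD(3-5)[OF S, of x] by simp
    fix a assume a: "a \<in> ?T" "a \<noteq> u"
    then obtain b where b: "b \<in> S" "a < b" "b < f a" using chains_next[OF S, of a] by blast
    moreover have "v \<le> a" using chainsD(4)[OF S, of a] a by simp
    ultimately show "\<exists>b\<in>?T. a < b \<and> b < f a" by (intro bexI[of _ b]) simp_all
  qed (use wT u in simp_all)
  ultimately have "insert v ?T \<in> (\<Union>w\<in>jumps \<inter> {v<..<f v}. insert v ` chains w u)"
    by (intro UN_I[of w] imageI) simp_all
  moreover have "insert v ?T = S" using chainsD(1)[OF S] by blast
  ultimately show "S \<in> (\<Union>w\<in>jumps \<inter> {v<..<f v}. insert v ` chains w u)" by simp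
next
  fix S assume "S \<in> (\<Union>w\<in>jumps \<inter> {v<..<f v}. insert v ` chains w u)"
  then obtain w T where w: "w \<in> jumps" "v < w" "w < f v" and T: "T \<in> chains w u"
    and S: "S = insert v T" by auto
  show "S \<in> chains v u"
  proof (rule chainsI)
    show "x \<in> jumps \<and> v \<le> x \<and> x \<le> u" if "x \<in> S" for x
      using that S assms w chainsD(3-5)[OF T, of x] by auto
    fix a assume a: "a \<in> S" "a \<noteq> u"
    show "\<exists>b\<in>S. a < b \<and> b < f a"
    proof (cases "a \<in> T")
      case True
      then show ?thesis using chains_next[OF T True a(2)] S by blast
    next
      case False
      then show ?thesis using a S w chainsD(1)[OF T] by blast
    qed
  qed (use S chainsD(2)[OF T] in simp_all)
qed

text \<open>
  The entry of \<open>Z\<^sup>-\<^sup>1 (1 + F + F\<^sup>2 + \<dots>)\<close>, up to sign. In the recursion over the second point \<open>w\<close> of the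
  chain the claimed values telescope, because at points that are not jumps the two terms agree. What
  remains are the orbits of \<open>v + 1\<close> and of \<open>f v\<close>, and the latter is the orbit of \<open>v\<close> without its first
  point.
\<close>

lemma chain_sum:
  assumes u: "u \<in> jumps" and "v \<in> jumps"
  shows "(\<Sum>S\<in>chains v u. (- 1) ^ card S) = (of_bool (reach (Suc v) u) - of_bool (reach v u) :: int)"
  using assms(2)
proof (induction "u - v" arbitrary: v rule: less_induct)
  case less
  consider "u < v" | "u = v" | "v < u" by linarith
  then show ?case
  proof cases
    case 1
    then have "S \<notin> chains v u" for S using chainsD(2)[of S v u] chainsD(4)[of S v u u] by auto
    then have "chains v u = {}" by blast
    with 1 u show ?thesis by (simp add: reach_less)
  next
    case 2
    have "S = {u}" if "S \<in> chains u u" for S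
      using chainsD(2,4,5)[OF that] by (intro equalityI subsetI) (simp_all add: order.antisym)
    moreover have "{u} \<in> chains u u" using u by (intro chainsI) simp_all
    ultimately have "chains v u = {{u}}" using 2 by blast
    moreover have "reach u u" unfolding reach_def by (rule exI[of _ 0]) simp
    ultimately show ?thesis using 2 u by (simp add: reach_less)
  next
    case 3
    let ?W = "jumps \<inter> {v<..<f v}"
    let ?d = "\<lambda>w. of_bool (reach (Suc w) u) - of_bool (reach w u) :: int"
    have notin: "v \<notin> S" if "S \<in> chains w u" "v < w" for S w
      using chainsD(4)[OF that(1), of v] that(2) by auto
    have "(\<Sum>S\<in>chains v u. (- 1) ^ card S) = (\<Sum>w\<in>?W. \<Sum>S\<in>insert v ` chains w u. (- 1) ^ card S :: int)"
      unfolding chains_step[OF less.prems 3]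
    proof (rule sum.UNION_disjoint)
      show "\<forall>i\<in>?W. \<forall>j\<in>?W. i \<noteq> j \<longrightarrow> insert v ` chains i u \<inter> insert v ` chains j u = {}"
      proof (intro ballI impI)
        fix i j assume ij: "i \<in> ?W" "j \<in> ?W" "i \<noteq> j"
        { fix S T assume S: "S \<in> chains i u" and T: "T \<in> chains j u" and eq: "insert v S = insert v T"
          have "v \<notin> S" "v \<notin> T" using notin[OF S] notin[OF T] ij by simp_all
          then have "S = T" using eq by (simp add: insert_ident)
          then have False using chains_Min[OF S] chains_Min[OF T] ij by simp }
        then show "insert v ` chains i u \<inter> insert v ` chains j u = {}" by blast
      qed
    qed (auto simp: chains_finite)
    also have "\<dots> = (\<Sum>w\<in>?W. - ?d w)"
    proof (rule sum.cong[OF refl])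
      fix w assume w: "w \<in> ?W"
      \<comment> \<open>prepending \<open>v\<close> to a chain adds one element and flips the sign\<close>
      have "inj_on (insert v) (chains w u)"
      proof (rule inj_onI)
        fix S T assume S: "S \<in> chains w u" and T: "T \<in> chains w u" and eq: "insert v S = insert v T"
        have "v \<notin> S" "v \<notin> T" using notin[OF S] notin[OF T] w by simp_all
        then show "S = T" using eq by (simp add: insert_ident)
      qed
      then have "(\<Sum>S\<in>insert v ` chains w u. (- 1) ^ card S :: int) = (\<Sum>S\<in>chains w u. (- 1) ^ card (insert v S))"
        by (rule sum.reindex_cong) auto
      also have "\<dots> = (\<Sum>S\<in>chains w u. - ((- 1) ^ card S))"
      proof (rule sum.cong[OF refl])
        fix S assume S: "S \<in> chains w u"
        then have "card (insert v S) = Suc (card S)"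
          using notin[OF S] w chains_member_finite[OF S] by simp
        then show "(- 1) ^ card (insert v S) = - ((- 1 :: int) ^ card S)" by simp
      qed
      also have "\<dots> = - (\<Sum>S\<in>chains w u. (- 1) ^ card S)" by (rule sum_negf)
      also have "(\<Sum>S\<in>chains w u. (- 1) ^ card S) = ?d w"
        using less.hyps[of w] w 3 by auto
      finally show "(\<Sum>S\<in>insert v ` chains w u. (- 1) ^ card S :: int) = - ?d w" .
    qed
    also have "\<dots> = (\<Sum>w\<in>{Suc v..<f v}. - ?d w)"
      by (rule sum.mono_neutral_left) (auto simp: reach_not_jump)
    also have "\<dots> = - (\<Sum>w\<in>{Suc v..<f v}. ?d w)" by (rule sum_negf)
    also have "(\<Sum>w\<in>{Suc v..<f v}. ?d w) = of_bool (reach (f v) u) - of_bool (reach (Suc v) u)"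
      using incr[of v] by (intro sum_Suc_diff') simp
    finally show ?thesis
      using reach_step[OF u less.prems] 3 by simp
  qed
qed

definition covers :: "nat set \<Rightarrow> bool" where
  "covers S \<longleftrightarrow> (\<forall>v<n. \<exists>a\<in>S. \<exists>k. a < v + k * n \<and> v + k * n < f a)"

text \<open>
  If some successor \<open>b\<close> of \<open>a\<close> in \<open>S\<close> had \<open>f a \<le> b\<close>, then \<open>b\<close> would be interior to no interval of a point of \<open>S\<close>
  or its translates: those starting at or before \<open>a\<close> end too early by monotonicity, the others start too late. The inequality
  between \<open>Min S + n\<close> and \<open>f (Max S)\<close> is the same condition for the step that closes the cycle.
\<close>

lemma covers_iff_chain:
  assumes S: "S \<subseteq> jumps \<inter> {..<n}" and ne: "S \<noteq> {}"
  shows "covers S \<longleftrightarrow> S \<in> chains (Min S) (Max S) \<and> Min S + n < f (Max S)"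
proof -
  have fin: "finite S" using S by (rule finite_subset[OF _ finite_Int]) auto
  let ?s = "Min S" and ?u = "Max S"
  have sS: "?s \<in> S" and uS: "?u \<in> S" using fin ne by auto
  have sle: "?s \<le> a" and ule: "a \<le> ?u" if "a \<in> S" for a using fin that by auto
  have lt: "a < n" if "a \<in> S" for a using S that by auto
  show ?thesis
  proof
    assume cov: "covers S"
    have "\<exists>b\<in>S. a < b \<and> b < f a" if a: "a \<in> S" "a \<noteq> ?u" for a
    proof -
      let ?B = "{b\<in>S. a < b}"
      have "?u \<in> ?B" using a ule[of a] uS by auto
      define b where "b = Min ?B"
      have b: "b \<in> ?B" unfolding b_def using fin \<open>?u \<in> ?B\<close> by (intro Min_in) auto
      have ble: "b \<le> c" if "c \<in> S" "a < c" for c unfolding b_def using fin that by (intro Min_le) auto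
      from cov lt b obtain c k where c: "c \<in> S" "c < b + k * n" "b + k * n < f c"
        unfolding covers_def by blast
      \<comment> \<open>\<open>b\<close> lies in a translate of the interval of some \<open>c\<close> that starts no later than \<open>a\<close>, so monotonicity gives \<open>b < f a\<close>\<close>
      have "c \<le> a + k * n"
      proof (cases k)
        case 0
        have False if "a < c" using ble[OF c(1) that] c(2) 0 by simp
        then show ?thesis using 0 by force
      next
        case (Suc m) then show ?thesis using lt[OF c(1)] by simp
      qed
      from f_le[OF this] c(3) have "b < f a" by (simp add: shift_mult)
      with b show ?thesis by blast
    qed
    moreover have "?s + n < f ?u"
    proof -
      from cov lt sS obtain c k where c: "c \<in> S" "c < ?s + k * n" "?s + k * n < f c"
        unfolding covers_def by blast
      obtain m where k: "k = Suc m" using c sle[of c] by (cases k) auto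
      have "c \<le> ?u + m * n" using ule[OF c(1)] by simp
      from f_le[OF this] c(3) k show ?thesis by (simp add: shift_mult)
    qed
    ultimately show "S \<in> chains ?s ?u \<and> ?s + n < f ?u"
      using S sS uS sle ule by (intro conjI chainsI) auto
  next
    assume *: "S \<in> chains ?s ?u \<and> ?s + n < f ?u"
    show "covers S"
      unfolding covers_def
    proof (intro allI impI)
      fix v assume v: "v < n"
      show "\<exists>a\<in>S. \<exists>k. a < v + k * n \<and> v + k * n < f a"
      proof (cases "?s < v")
        case True
        let ?B = "{b\<in>S. b < v}"
        define a where "a = Max ?B"
        have a: "a \<in> ?B" unfolding a_def using fin sS True by (intro Max_in) auto
        have ale: "c \<le> a" if "c \<in> S" "c < v" for c unfolding a_def using fin that by (intro Max_ge) auto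
        have "v < f a"
        proof (cases "a = ?u")
          case True
          then show ?thesis using * v by simp
        next
          case False
          then obtain b where "b \<in> S" "a < b" "b < f a" using * a by (blast elim: chains_next)
          with ale[of b] show ?thesis by force
        qed
        with a show ?thesis by (intro bexI[of _ a] exI[of _ 0]) auto
      next
        case False
        with * uS lt[OF uS] show ?thesis by (intro bexI[of _ ?u] exI[of _ 1]) auto
      qed
    qed
  qed
qed


definition starts :: "nat set" where
  "starts = jumps \<inter> {..<n}"

text \<open>
  Modulo \<open>n\<close>, the vertices on the cycles of weight one.
\<close>

definition returns :: "nat \<Rightarrow> bool" where
  "returns b \<longleftrightarrow> (\<exists>k. (f ^^ Suc k) b = b + n)"

text \<open>
  The points from which a closed orbit of weight one leaves the window \<open>{f 0..<f n}\<close>. Since \<open>f\<close> is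
  increasing along orbits, each such orbit has exactly one of them modulo \<open>n\<close>. The window starts at \<open>f 0\<close>
  rather than \<open>0\<close> because it has to be the image of one period of jumps.
\<close>

definition crossings :: "nat set" where
  "crossings = {b. f 0 \<le> b \<and> b < f n \<and> f n \<le> f b \<and> returns b}"

lemma f_n: "f n = f 0 + n"
  using shift[of 0] by simp

lemma starts_finite: "finite starts"
  by (simp add: starts_def)

text \<open>
  The greatest point of a fibre of \<open>f\<close> is a jump; the hypothesis \<open>f v < f n\<close> keeps it below \<open>n\<close>.
\<close>

lemma start_above:
  assumes "v < n" "f v < f n"
  obtains u where "u \<in> starts" "f u = f v"
proof -
  define u where "u = Max {w. w < n \<and> f w = f v}"
  have fin: "finite {w. w < n \<and> f w = f v}" by simp
  have "u \<in> {w. w < n \<and> f w = f v}" unfolding u_def using assms by (intro Max_in[OF fin]) auto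
  then have u: "u < n" "f u = f v" by simp_all
  have "f (Suc u) \<noteq> f v"
  proof
    assume eq: "f (Suc u) = f v"
    with assms u have "Suc u < n" by (metis Suc_lessI less_irrefl)
    with eq fin have "Suc u \<le> u" unfolding u_def by (intro Max_ge) auto
    then show False by simp
  qed
  with u f_le[of u "Suc u"] have "u \<in> starts" by (auto simp: starts_def jumps_def)
  with u that show thesis by blast
qed

lemma start_bounds: "u \<in> starts \<Longrightarrow> f 0 \<le> f u \<and> f u < f n"
  unfolding starts_def by (auto simp: f_le jump_less)

lemma image_starts: "f ` starts = {b \<in> range f. f 0 \<le> b \<and> b < f n}"
proof (intro equalityI subsetI)
  fix b assume "b \<in> {b \<in> range f. f 0 \<le> b \<and> b < f n}"
  then obtain v where v: "b = f v" "f v < f n" by auto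
  then have "v < n" using f_le[of n v] by (metis leD leI)
  with v show "b \<in> f ` starts" by (metis start_above imageI)
qed (use start_bounds in auto)

lemma starts_nonempty: "starts \<noteq> {}"
  using start_above[of 0] n_pos f_n by auto

lemma returns_range:
  assumes "returns b" "f 0 \<le> b" shows "b \<in> range f"
proof -
  from assms obtain k where "f ((f ^^ k) b) = b + n" unfolding returns_def by auto
  then obtain y where y: "f y = b + n" by blast
  show ?thesis
  proof (cases "n \<le> y")
    case True
    then have "f (y - n) = b" using shift[of "y - n"] y by simp
    then show ?thesis by blast
  next
    case False
    then have "f y \<le> f n" by (intro f_le) simp
    with y assms f_n have "b = f 0" by simp
    then show ?thesis by simp
  qed
qed

text \<open>
  The orbit of \<open>0\<close> increases strictly from \<open>f 0\<close>, so there is exactly one last member of it below \<open>f n\<close>.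
\<close>

lemma orbit_crosses_once:
  "card {b. f 0 \<le> b \<and> b < f n \<and> f n \<le> f b \<and> (\<exists>k. (f ^^ Suc k) 0 = b)} = 1"
proof -
  let ?g = "\<lambda>k. (f ^^ k) 0"
  define K where "K = (LEAST k. f n \<le> ?g k)"
  have ex: "f n \<le> ?g (f n)" using funpow_increasing[of 0 "f n"] by simp
  have K: "f n \<le> ?g K" unfolding K_def using ex by (rule LeastI)
  have below: "?g k < f n" if "k < K" for k
    using not_less_Least[of k "\<lambda>k. f n \<le> ?g k"] that unfolding K_def by simp
  have "\<not> f n \<le> ?g 0" using incr[of n] by simp
  moreover have "\<not> f n \<le> ?g (Suc 0)" using f_n n_pos by simp
  ultimately obtain j where j: "K = Suc (Suc j)" using K by (metis not0_implies_Suc One_nat_def)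
  have "{b. f 0 \<le> b \<and> b < f n \<and> f n \<le> f b \<and> (\<exists>k. ?g (Suc k) = b)} = {?g (Suc j)}"
  proof (intro equalityI subsetI)
    fix b assume "b \<in> {b. f 0 \<le> b \<and> b < f n \<and> f n \<le> f b \<and> (\<exists>k. ?g (Suc k) = b)}"
    then obtain k where b: "b = ?g (Suc k)" "b < f n" "f n \<le> ?g (Suc (Suc k))" by auto
    have "\<not> Suc (Suc k) < K" using below[of "Suc (Suc k)"] b by auto
    moreover have "\<not> K \<le> Suc k" using funpow_le[of K "Suc k" 0] K b by auto
    ultimately have "k = j" using j by simp
    with b show "b \<in> {?g (Suc j)}" by simp
  next
    fix b assume "b \<in> {?g (Suc j)}"
    moreover have "f 0 \<le> ?g (Suc j)" by (simp add: f_le)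
    ultimately show "b \<in> {b. f 0 \<le> b \<and> b < f n \<and> f n \<le> f b \<and> (\<exists>k. ?g (Suc k) = b)}"
      using below[of "Suc j"] K j by auto
  qed
  then show ?thesis by simp
qed

text \<open>
  The left-hand side is what telescoping over the first point leaves for the last point \<open>u\<close>; the
  truncated difference \<open>f u - n\<close> makes it vanish when no first point is admissible. If \<open>n \<le> f u\<close>, then
  shifting by \<open>n\<close> turns the first term into the return of \<open>f u\<close>. If \<open>f u < n\<close> although \<open>f n \<le> f (f u)\<close>, then
  the orbit of \<open>f u\<close> merges with that of \<open>n\<close>, so the two terms on the right cancel as well. Including
  these \<open>u\<close> lets the sum range over all exits from the window.
\<close>

lemma closing_term:
  assumes u: "u \<in> starts"
  shows "(of_bool (reach (f u - n) u) - of_bool (reach 0 u) :: int) =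
    (if f n \<le> f (f u) then of_bool (returns (f u)) - of_bool (\<exists>k. (f ^^ Suc k) 0 = f u) else 0)"
proof (cases "f n \<le> f (f u)")
  case False
  then have "f u < n" using f_le[of n "f u"] by (metis leI)
  with False show ?thesis by simp
next
  case True
  show ?thesis
  proof (cases "n \<le> f u")
    case True
    have "(f ^^ Suc k) (f u - n) = f u \<longleftrightarrow> (f ^^ Suc k) (f u) = f u + n" for k
      using funpow_shift[of "Suc k" "f u - n" 1] True by simp
    then show ?thesis using \<open>f n \<le> f (f u)\<close> unfolding reach_def returns_def by simp
  next
    case False
    then have "f (f u) = f n" using f_le[of "f u" n] True by simp
    then have "f (f u) = f 0 + n" by (simp add: f_n)
    then have "(f ^^ Suc k) (f u) = (f ^^ Suc k) 0 + n" for k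
      using funpow_shift[of k "f 0" 1] by (simp only: funpow_Suc_right o_apply mult_1)
    then show ?thesis using True False unfolding reach_def returns_def by simp
  qed
qed

text \<open>
  Sort the covering sets by their last point \<open>u\<close>, then by their first point. The sum over the first point
  telescopes, and since \<open>f\<close> is injective on the starting points, \<open>u\<close> may be replaced by \<open>b = f u\<close>.
\<close>

lemma covering_sum:
  "(\<Sum>S | S \<subseteq> starts \<and> S \<noteq> {} \<and> covers S. (- 1) ^ card S) = (int (card crossings) - 1)"
proof -
  let ?r = "\<lambda>v u. of_bool (reach v u) :: int"
  \<comment> \<open>the possible first points for the last point \<open>u\<close>; first points beyond \<open>u\<close> do no harm, as there is no chain from them to \<open>u\<close>\<close>
  let ?A = "\<lambda>u. {s \<in> jumps. s < f u - n}"
  have *: "{S. S \<subseteq> starts \<and> S \<noteq> {} \<and> covers S} = (\<Union>u\<in>starts. \<Union>s\<in>?A u. chains s u)"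
  proof (intro equalityI subsetI)
    fix S assume "S \<in> {S. S \<subseteq> starts \<and> S \<noteq> {} \<and> covers S}"
    then have S: "S \<subseteq> starts" "S \<noteq> {}" "covers S" by auto
    then have "S \<in> chains (Min S) (Max S)" "Min S + n < f (Max S)"
      using covers_iff_chain[of S] by (auto simp: starts_def)
    moreover have "Min S \<in> starts" "Max S \<in> starts"
      using S starts_finite by (meson Min_in Max_in finite_subset subsetD)+
    ultimately show "S \<in> (\<Union>u\<in>starts. \<Union>s\<in>?A u. chains s u)"
      by (auto simp: starts_def less_diff_conv intro!: bexI[of _ "Max S"] exI[of _ "Min S"])
  next
    fix S assume "S \<in> (\<Union>u\<in>starts. \<Union>s\<in>?A u. chains s u)"
    then obtain u s where u: "u \<in> starts" "s \<in> jumps" "s + n < f u" "S \<in> chains s u"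
      by (auto simp: less_diff_conv)
    have S: "S \<subseteq> jumps \<inter> {..<n}" "S \<noteq> {}"
      using u chainsD[OF u(4)] by (force simp: starts_def)+
    then show "S \<in> {S. S \<subseteq> starts \<and> S \<noteq> {} \<and> covers S}"
      using covers_iff_chain[OF S] chains_Min[OF u(4)] chains_Max[OF u(4)] u by (simp add: starts_def)
  qed
  have "(\<Sum>S | S \<subseteq> starts \<and> S \<noteq> {} \<and> covers S. (- 1) ^ card S :: int) =
      (\<Sum>u\<in>starts. \<Sum>S\<in>(\<Union>s\<in>?A u. chains s u). (- 1) ^ card S)"
    unfolding *
  proof (rule sum.UNION_disjoint)
    show "\<forall>u\<in>starts. finite (\<Union>s\<in>?A u. chains s u)" by (auto simp: chains_finite)
    show "\<forall>i\<in>starts. \<forall>j\<in>starts. i \<noteq> j \<longrightarrow>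
        (\<Union>s\<in>?A i. chains s i) \<inter> (\<Union>s\<in>?A j. chains s j) = {}"
      by (auto dest!: chains_Max)
  qed (rule starts_finite)
  also have "\<dots> = (\<Sum>u\<in>starts. \<Sum>s\<in>?A u. \<Sum>S\<in>chains s u. (- 1) ^ card S)"
  proof (rule sum.cong[OF refl], rule sum.UNION_disjoint)
    fix u
    show "\<forall>i\<in>?A u. \<forall>j\<in>?A u. i \<noteq> j \<longrightarrow> chains i u \<inter> chains j u = {}"
      by (auto dest!: chains_Min)
  qed (auto simp: chains_finite)
  also have "\<dots> = (\<Sum>u\<in>starts. \<Sum>s\<in>?A u. ?r (Suc s) u - ?r s u)"
    by (intro sum.cong refl chain_sum) (auto simp: starts_def)
  also have "\<dots> = (\<Sum>u\<in>starts. \<Sum>s<f u - n. ?r (Suc s) u - ?r s u)"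
  proof (intro sum.cong[OF refl] sum.mono_neutral_left ballI)
    fix u s assume "s \<in> {..<f u - n} - ?A u"
    then have "s \<notin> jumps" by auto
    then show "?r (Suc s) u - ?r s u = 0" by (simp add: reach_not_jump)
  qed auto
  also have "\<dots> = (\<Sum>u\<in>starts. ?r (f u - n) u - ?r 0 u)"
    by (intro sum.cong[OF refl] sum_lessThan_telescope)
  also have "\<dots> = (\<Sum>u\<in>starts. if f n \<le> f (f u) then
      of_bool (returns (f u)) - of_bool (\<exists>k. (f ^^ Suc k) 0 = f u) else 0)"
    by (intro sum.cong[OF refl] closing_term)
  also have "\<dots> = (\<Sum>b\<in>f ` starts. if f n \<le> f b then
      of_bool (returns b) - of_bool (\<exists>k. (f ^^ Suc k) 0 = b) else 0)"
    by (rule sum.reindex_cong[symmetric, OF _ refl refl, simplified])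
      (rule inj_on_subset[OF inj_on_jumps], simp add: starts_def)
  also have "\<dots> = (\<Sum>b\<in>f ` starts. of_bool (f n \<le> f b \<and> returns b) -
      of_bool (f n \<le> f b \<and> (\<exists>k. (f ^^ Suc k) 0 = b)))"
    by (intro sum.cong) auto
  also have "\<dots> = int (card {b \<in> f ` starts. f n \<le> f b \<and> returns b}) -
      int (card {b \<in> f ` starts. f n \<le> f b \<and> (\<exists>k. (f ^^ Suc k) 0 = b)})"
    using starts_finite by (simp add: sum_subtractf sum.If_cases of_bool_def Int_def)
  also have "{b \<in> f ` starts. f n \<le> f b \<and> returns b} = crossings"
    unfolding image_starts crossings_def using returns_range by auto
  also have "{b \<in> f ` starts. f n \<le> f b \<and> (\<exists>k. (f ^^ Suc k) 0 = b)} =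
      {b. f 0 \<le> b \<and> b < f n \<and> f n \<le> f b \<and> (\<exists>k. (f ^^ Suc k) 0 = b)}"
    unfolding image_starts by auto
  finally show ?thesis using orbit_crosses_once by simp
qed

text \<open>
  All subsets of the nonempty set of starting points together have signed count \<open>0\<close>. The empty set
  contributes \<open>1\<close> to this, the covering sets the number of crossings minus \<open>1\<close>.
\<close>

lemma noncovering_sum:
  "(\<Sum>S | S \<subseteq> starts \<and> S \<noteq> {} \<and> \<not> covers S. (- 1) ^ (card S - 1)) = int (card crossings)"
proof -
  have fin: "finite {S. S \<subseteq> starts \<and> P S}" for P
    by (rule finite_subset[of _ "Pow starts"]) (auto simp: starts_finite)
  let ?s = "\<lambda>S. (- 1) ^ card S :: int"
  have "(\<Sum>S | S \<subseteq> starts \<and> S \<noteq> {} \<and> \<not> covers S. (- 1) ^ (card S - 1)) =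
      (\<Sum>S | S \<subseteq> starts \<and> S \<noteq> {} \<and> \<not> covers S. - ?s S)"
  proof (rule sum.cong[OF refl])
    fix S assume "S \<in> {S. S \<subseteq> starts \<and> S \<noteq> {} \<and> \<not> covers S}"
    then have "card S \<noteq> 0" using starts_finite by (auto simp: finite_subset)
    then show "(- 1) ^ (card S - 1) = - ?s S" by (cases "card S") auto
  qed
  also have "\<dots> = - (\<Sum>S | S \<subseteq> starts \<and> S \<noteq> {} \<and> \<not> covers S. ?s S)"
    by (rule sum_negf)
  finally have 1: "(\<Sum>S | S \<subseteq> starts \<and> S \<noteq> {} \<and> \<not> covers S. (- 1) ^ (card S - 1)) =
      - (\<Sum>S | S \<subseteq> starts \<and> S \<noteq> {} \<and> \<not> covers S. ?s S)" .
  have "(\<Sum>S | S \<subseteq> starts. ?s S) = 0"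
    using prod_diff_conv_sum[OF starts_finite, of "\<lambda>_. 1 :: int" "\<lambda>_. 1"] starts_nonempty starts_finite
    by (simp add: Pow_def power_0_left)
  also have "{S. S \<subseteq> starts} = insert {} ({S. S \<subseteq> starts \<and> S \<noteq> {} \<and> covers S} \<union>
      {S. S \<subseteq> starts \<and> S \<noteq> {} \<and> \<not> covers S})" by blast
  also have "sum ?s \<dots> = 1 + ((\<Sum>S | S \<subseteq> starts \<and> S \<noteq> {} \<and> covers S. ?s S) +
      (\<Sum>S | S \<subseteq> starts \<and> S \<noteq> {} \<and> \<not> covers S. ?s S))"
    by (subst sum.insert, use fin in force, blast, subst sum.union_disjoint) (use fin in auto)
  finally show ?thesis using 1 covering_sum by linarith
qed

end

section \<open>Components of weight one in the graph of a periodic map\<close>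

context periodic_map begin

definition step :: "nat \<Rightarrow> nat" where
  "step i = f i mod n"

definition arrows :: "nat rel" where
  "arrows = {(i, j). i < n \<and> j = step i}"

abbreviation linked :: "nat rel" where
  "linked \<equiv> (arrows \<union> arrows\<inverse>)\<^sup>*"

lemma f_reduce: "f v = v + (f (v mod n) - v mod n)"
proof -
  have "f v = f (v mod n) + v div n * n"
    using shift_mult[of "v mod n" "v div n"] by simp
  then show ?thesis using incr[of "v mod n"] div_mult_mod_eq[of v n] by linarith
qed

lemma step_mod: "step (v mod n) = f v mod n"
  using shift_mult[of "v mod n" "v div n"] div_mult_mod_eq[of v n]
  unfolding step_def by (metis add.commute mod_mult_self1)

lemma step_funpow: "(step ^^ k) (v mod n) = (f ^^ k) v mod n"
  by (induction k) (simp_all add: step_mod)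

lemma step_less: "step v < n"
  using n_pos by (simp add: step_def)

lemma step_funpow_less: "i < n \<Longrightarrow> (step ^^ k) i < n"
  by (cases k) (simp_all add: step_less)

lemma linked_sym: "(i, j) \<in> linked \<Longrightarrow> (j, i) \<in> linked"
  by (metis symD sym_Un_converse sym_rtrancl)

lemma linked_funpow: "i < n \<Longrightarrow> (i, (step ^^ k) i) \<in> linked"
proof (induction k)
  case (Suc k)
  have "((step ^^ k) i, (step ^^ Suc k) i) \<in> arrows \<union> arrows\<inverse>"
    using step_funpow_less[OF Suc.prems] by (simp add: arrows_def)
  with Suc show ?case by (meson rtrancl.rtrancl_into_rtrancl)
qed simp

text \<open>
  Following an arrow \<open>j \<rightarrow> step j\<close> in either direction increases just one of the two exponents.
\<close>

lemma linked_merge: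
  assumes "(i, j) \<in> linked"
  obtains p q where "(step ^^ p) i = (step ^^ q) j"
  using assms
proof (induction arbitrary: thesis rule: rtrancl_induct)
  case base
  show ?case by (rule base[of 0 0]) simp
next
  case (step j k)
  obtain p q where pq: "(step ^^ p) i = (step ^^ q) j" using step.IH by blast
  from step.hyps(2) consider "k = local.step j" | "j = local.step k" by (auto simp: arrows_def)
  then show ?case
  proof cases
    case 1
    then have "(local.step ^^ Suc p) i = (local.step ^^ q) k" using pq by (simp add: funpow_swap1)
    then show ?thesis by (rule step.prems)
  next
    case 2
    then have "(local.step ^^ p) i = (local.step ^^ Suc q) k" using pq by (simp add: funpow_swap1)
    then show ?thesis by (rule step.prems)
  qed
qed

lemma linked_less: "(i, j) \<in> linked \<Longrightarrow> i < n \<Longrightarrow> j < n"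
  by (induction rule: rtrancl_induct) (auto simp: arrows_def step_less)

text \<open>
  A periodic point is reached from every point of its component, which is why a component contains only
  one cycle.
\<close>

lemma linked_periodic:
  assumes "(i, j) \<in> linked" "(step ^^ m) j = j" "0 < m"
  obtains r where "(step ^^ r) i = j"
proof -
  obtain p q where pq: "(step ^^ p) i = (step ^^ q) j" using linked_merge[OF assms(1)] by blast
  have per: "(step ^^ (q * m)) j = j" by (induction q) (simp_all add: funpow_add assms(2))
  have "(step ^^ (q * m - q + p)) i = (step ^^ (q * m - q + q)) j"
    by (simp only: funpow_add o_apply pq)
  also have "q * m - q + q = q * m" using assms(3) by simp
  finally have "(step ^^ (q * m - q + p)) i = (step ^^ (q * m)) j" .
  with per that show thesis by metis
qed

lemma returns_shift: "returns (v + k * n) \<longleftrightarrow> returns v"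
  unfolding returns_def funpow_shift by auto

lemma returns_mod: "returns (v mod n) \<longleftrightarrow> returns v"
  using returns_shift[of "v mod n" "v div n"] by simp

lemma returns_funpow: "returns v \<Longrightarrow> returns ((f ^^ j) v)"
proof -
  assume "returns v"
  then obtain k where "(f ^^ Suc k) v = v + n" unfolding returns_def by blast
  then have "(f ^^ Suc k) ((f ^^ j) v) = (f ^^ j) (v + n)"
    by (metis funpow_add add.commute o_apply)
  then show ?thesis using funpow_shift[of j v 1] unfolding returns_def by (metis mult_1)
qed

lemma returns_step: "i < n \<Longrightarrow> returns i \<Longrightarrow> returns ((step ^^ j) i)"
  using step_funpow[of j i] returns_funpow[of i j] returns_mod by simp

text \<open>
  The lift of an oriented cycle to the line is the \<open>f\<close>-orbit of its first vertex.
\<close>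

lemma oriented_cycle_mod:
  assumes c: "oriented_cycle arrows c"
  shows "(f ^^ k) (c ! 0) mod n = c ! (k mod length c)"
proof (induction k)
  case 0
  have "0 < length c" using c by (simp add: oriented_cycle_def)
  then have "c ! 0 < n" using c by (auto simp: oriented_cycle_def arrows_def)
  then show ?case by simp
next
  case (Suc k)
  let ?m = "length c" and ?x = "(f ^^ k) (c ! 0)"
  have m: "0 < ?m" using c by (simp add: oriented_cycle_def)
  then have "c ! (Suc (k mod ?m) mod ?m) = step (c ! (k mod ?m))"
    using c by (simp add: oriented_cycle_def arrows_def)
  then show ?case
    using Suc step_mod[of ?x] by (simp add: mod_Suc_eq)
qed

lemma oriented_cycle_sum:
  assumes c: "oriented_cycle arrows c"
  shows "k \<le> length c \<Longrightarrow> (f ^^ k) (c ! 0) = c ! 0 + (\<Sum>j<k. f (c ! j) - c ! j)"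
proof (induction k)
  case (Suc k)
  have "(f ^^ k) (c ! 0) mod n = c ! k" using oriented_cycle_mod[OF c, of k] Suc.prems by simp
  then have "f ((f ^^ k) (c ! 0)) = (f ^^ k) (c ! 0) + (f (c ! k) - c ! k)"
    using f_reduce[of "(f ^^ k) (c ! 0)"] by simp
  then show ?case using Suc by simp
qed simp

text \<open>
  Going once around the cycle moves its first vertex by the sum of the lengths, a positive multiple of
  \<open>n\<close>. If the component contains a returning point, then it reaches the cycle, so the first vertex returns
  after some number of steps with displacement \<open>n\<close>. The cycle closes no later than that, which forces
  its displacement to be \<open>n\<close>.
\<close>

lemma oriented_cycle_weight:
  assumes c: "oriented_cycle arrows c" and linked: "\<And>i. i \<in> set c \<Longrightarrow> (i0, i) \<in> linked"
    and i0: "i0 < n"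
  shows "(\<Sum>i\<leftarrow>c. f i - i) = n \<longleftrightarrow> (\<exists>i. (i0, i) \<in> linked \<and> returns i)"
proof -
  let ?m = "length c" and ?c = "c ! 0"
  have m: "0 < ?m" and dist: "distinct c" using c by (simp_all add: oriented_cycle_def)
  have cmem: "?c \<in> set c" using m by simp
  have cn: "?c < n" using linked_less[OF linked[OF cmem] i0] .
  have full: "(f ^^ ?m) ?c = ?c + (\<Sum>i\<leftarrow>c. f i - i)"
    using oriented_cycle_sum[OF c, of ?m] by (simp add: sum_list_sum_nth atLeast0LessThan)
  show ?thesis
  proof
    assume "(\<Sum>i\<leftarrow>c. f i - i) = n"
    then have "returns ?c" using full m unfolding returns_def by (metis Suc_pred)
    with linked[OF cmem] show "\<exists>i. (i0, i) \<in> linked \<and> returns i" by blast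
  next
    assume "\<exists>i. (i0, i) \<in> linked \<and> returns i"
    then obtain i where i: "(i0, i) \<in> linked" "returns i" by blast
    have "(i, ?c) \<in> linked" using linked_sym[OF i(1)] linked[OF cmem] by (rule rtrancl_trans)
    moreover have "(step ^^ ?m) ?c = ?c"
      using oriented_cycle_mod[OF c, of ?m] step_funpow[of ?m ?c] cn by (simp del: funpow.simps)
    ultimately obtain r where "(step ^^ r) i = ?c" using m by (rule linked_periodic)
    then have "returns ?c" using returns_step[of i r] linked_less[OF i(1) i0] i(2) by simp
    then obtain k where k: "(f ^^ Suc k) ?c = ?c + n" unfolding returns_def by blast
    then have "c ! (Suc k mod ?m) = c ! 0"
      using oriented_cycle_mod[OF c, of "Suc k"] cn by simp
    then have "Suc k mod ?m = 0" using dist m by (simp add: nth_eq_iff_index_eq)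
    then have "?m \<le> Suc k" by (simp add: dvd_imp_le mod_0_imp_dvd)
    then have "(f ^^ ?m) ?c \<le> ?c + n" using funpow_le[of ?m "Suc k" ?c] k by simp
    moreover have "?c < (f ^^ ?m) ?c" using funpow_strict[OF m, of ?c] by simp
    moreover have "(?c + (\<Sum>i\<leftarrow>c. f i - i)) mod n = ?c mod n"
      using oriented_cycle_mod[OF c, of ?m] full cn by simp
    then have "n dvd (\<Sum>i\<leftarrow>c. f i - i)" by (simp add: mod_eq_dvd_iff_nat)
    ultimately show "(\<Sum>i\<leftarrow>c. f i - i) = n" using full by (auto dest: dvd_imp_le)
  qed
qed

text \<open>
  Finitely many vertices make the forward orbit of \<open>i\<close> eventually periodic. The period is chosen minimal
  to get distinct vertices.
\<close>

lemma oriented_cycle_exists: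
  assumes i: "i < n"
  obtains c where "oriented_cycle arrows c" "\<And>j. j \<in> set c \<Longrightarrow> (i, j) \<in> linked"
proof -
  have "finite (range (\<lambda>k. (step ^^ k) i))"
    by (rule finite_subset[of _ "{..<n}"]) (use step_funpow_less[OF i] in auto)
  then have "\<not> inj (\<lambda>k. (step ^^ k) i)" using finite_imageD infinite_UNIV_nat by blast
  then obtain a b where ab: "(step ^^ a) i = (step ^^ b) i" "a < b"
    using linorder_inj_onI'[of UNIV "\<lambda>k. (step ^^ k) i"] by blast
  define x where "x = (step ^^ a) i"
  have x: "x < n" "(i, x) \<in> linked" unfolding x_def using i by (auto simp: step_funpow_less linked_funpow)
  let ?P = "\<lambda>m. 0 < m \<and> (step ^^ m) x = x"
  have "(step ^^ (b - a)) x = x"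
    using ab funpow_add[of "b - a" a step] by (simp add: x_def)
  with ab have ex: "?P (b - a)" by simp
  define m where "m = (LEAST m. ?P m)"
  have m: "0 < m" "(step ^^ m) x = x" using LeastI[of ?P, OF ex] unfolding m_def by simp_all
  have least: "\<not> ?P k" if "k < m" for k using not_less_Least that unfolding m_def by blast
  let ?c = "map (\<lambda>k. (step ^^ k) x) [0..<m]"
  have "(step ^^ k) x \<noteq> (step ^^ l) x" if "k < l" "l < m" for k l
  proof
    assume "(step ^^ k) x = (step ^^ l) x"
    then have "(step ^^ (m - l + k)) x = (step ^^ (m - l + l)) x" by (simp add: funpow_add)
    with m that have "?P (m - l + k)" by simp
    with least[of "m - l + k"] that show False by simp
  qed
  then have "inj_on (\<lambda>k. (step ^^ k) x) {0..<m}"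
    by (intro linorder_inj_onI') auto
  then have "distinct ?c" by (simp add: distinct_map)
  moreover have "(?c ! k, ?c ! (Suc k mod length ?c)) \<in> arrows" if "k < length ?c" for k
  proof -
    have "(step ^^ (Suc k mod m)) x = step ((step ^^ k) x)"
      using that m by (cases "Suc k = m") auto
    then show ?thesis using that m x by (simp add: arrows_def step_funpow_less)
  qed
  ultimately have "oriented_cycle arrows ?c" using m by (simp add: oriented_cycle_def)
  moreover have "(i, j) \<in> linked" if "j \<in> set ?c" for j
    using that x linked_funpow[OF x(1)] by (auto intro: rtrancl_trans)
  ultimately show thesis by (rule that)
qed

text \<open>
  If \<open>b\<close> and \<open>b'\<close> lie in one component, then \<open>b'\<close> is congruent to some \<open>f\<^sup>q b\<close> with \<open>q\<close> smaller than the
  period of \<open>b\<close>. For \<open>q > 0\<close> this iterate has already left the window, so it equals \<open>b' + n\<close>; one more step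
  would leave the next window too, but at \<open>b + n\<close> the orbit is still inside it.
\<close>

lemma crossings_inj:
  assumes b: "b \<in> crossings" and b': "b' \<in> crossings" and linked: "(b mod n, b' mod n) \<in> linked"
  shows "b = b'"
proof -
  note bs = b[unfolded crossings_def mem_Collect_eq] b'[unfolded crossings_def mem_Collect_eq]
  obtain k k' where k: "(f ^^ Suc k) b = b + n" and k': "(f ^^ Suc k') b' = b' + n"
    using bs unfolding returns_def by blast
  have "(step ^^ Suc k') (b' mod n) = b' mod n" unfolding step_funpow k' by simp
  with linked obtain r where r: "(step ^^ r) (b mod n) = b' mod n"
    by (rule linked_periodic) simp
  define q where "q = r mod Suc k"
  have per: "(f ^^ (t * Suc k)) b = b + t * n" for t
  proof (induction t)
    case (Suc t)
    have "(f ^^ (Suc t * Suc k)) b = (f ^^ Suc k) ((f ^^ (t * Suc k)) b)"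
      by (simp only: mult_Suc funpow_add o_apply)
    also have "\<dots> = b + Suc t * n" unfolding Suc funpow_shift k by simp
    finally show ?case .
  qed simp
  have "(f ^^ r) b = (f ^^ (q + (r div Suc k) * Suc k)) b" by (simp only: q_def mod_div_mult_eq)
  also have "\<dots> = (f ^^ q) b + (r div Suc k) * n"
    by (simp only: funpow_add o_apply per funpow_shift)
  finally have modq: "(f ^^ q) b mod n = b' mod n" using r unfolding step_funpow by simp
  have q: "q < Suc k" unfolding q_def by simp
  \<comment> \<open>within one period the orbit of \<open>b\<close> stays below \<open>b + n\<close>, hence below the end of the second window\<close>
  then have lt: "(f ^^ q) b < b + n" using funpow_strict[of q "Suc k" b] k by simp
  have ge: "b \<le> (f ^^ q) b" using funpow_increasing[of b q] by simp
  have window: "x = b' \<or> x = b' + n" if "x mod n = b' mod n" "f 0 \<le> x" "x < f 0 + 2 * n" for x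
  proof -
    have eq: "x mod n = b' mod n" "b' \<le> x + n" using that bs f_n by auto
    consider "x \<le> b'" | "b' < x" by linarith
    then show ?thesis
    proof cases
      case 1
      then have "n dvd b' - x" using eq(1)[symmetric] by (simp add: mod_eq_dvd_iff_nat)
      moreover have "b' - x < n" using that bs f_n by linarith
      ultimately show ?thesis using 1 by (auto dest: dvd_imp_le)
    next
      case 2
      then have "n dvd x - b'" using eq by (metis less_imp_le mod_eq_dvd_iff_nat)
      then obtain t where t: "x - b' = n * t" by (rule dvdE)
      have "n * t < n * 2" using t that bs f_n by linarith
      with 2 t have "t = 1" by (cases t) auto
      with 2 t show ?thesis by simp
    qed
  qed
  have alt: "(f ^^ q) b = b' \<or> (f ^^ q) b = b' + n"
    using window[OF modq] lt ge bs f_n by linarith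
  show ?thesis
  proof (cases q)
    case 0
    then show ?thesis using alt bs f_n by auto
  next
    case (Suc q')
    have "f b \<le> (f ^^ q) b" using funpow_le[of 1 q b] Suc by simp
    with alt bs have eq: "(f ^^ q) b = b' + n" by linarith
    then have "(f ^^ Suc q) b = f b' + n" by (simp add: shift)
    moreover have "(f ^^ Suc q) b \<le> b + n" using funpow_le[of "Suc q" "Suc k" b] q k by simp
    ultimately show ?thesis using bs f_n by linarith
  qed
qed

text \<open>
  Translate \<open>i\<close> by a multiple of \<open>n\<close> into the window and take the last member of its orbit in the
  window.
\<close>

lemma crossing_exists:
  assumes i: "i < n" "returns i"
  obtains b where "b \<in> crossings" "(i, b mod n) \<in> linked"
proof -
  \<comment> \<open>adding \<open>f 0 * n\<close> makes the difference nonnegative\<close>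
  let ?d = "i + f 0 * n - f 0"
  define x where "x = f 0 + ?d mod n"
  have le: "f 0 \<le> i + f 0 * n" using n_pos by (simp add: trans_le_add2)
  have "x + (?d div n) * n = i + f 0 * n"
    unfolding x_def using le div_mult_mod_eq[of ?d n] by linarith
  then have xmod: "x mod n = i" using i by (metis mod_less mod_mult_self1)
  have x: "f 0 \<le> x" "x < f n" unfolding x_def using n_pos f_n by auto
  define K where "K = (LEAST k. f n \<le> (f ^^ k) x)"
  have "f n \<le> (f ^^ f n) x" using funpow_increasing[of x "f n"] by simp
  then have K: "f n \<le> (f ^^ K) x" unfolding K_def by (rule LeastI)
  have below: "(f ^^ k) x < f n" if "k < K" for k
    using not_less_Least[of k "\<lambda>k. f n \<le> (f ^^ k) x"] that unfolding K_def by simp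
  obtain j where j: "K = Suc j" using K x by (cases K) auto
  let ?b = "(f ^^ j) x"
  have "returns ?b" using i xmod returns_mod[of x] by (intro returns_funpow) simp
  moreover have "f 0 \<le> ?b" using funpow_increasing[of x j] x by linarith
  ultimately have "?b \<in> crossings" using K below j by (simp add: crossings_def)
  moreover have "?b mod n = (step ^^ j) i" using step_funpow[of j x] xmod by simp
  then have "(i, ?b mod n) \<in> linked" using linked_funpow[OF i(1)] by simp
  ultimately show thesis by (rule that)
qed

text \<open>
  Every component with a returning point contains exactly one crossing modulo \<open>n\<close>.
\<close>

lemma card_returning_components:
  "card {C \<in> quiver_components {..<n} arrows. \<exists>i\<in>C. returns i} = card crossings"
proof -
  let ?g = "\<lambda>b. linked `` {b mod n}"
  have "bij_betw ?g crossings {C \<in> quiver_components {..<n} arrows. \<exists>i\<in>C. returns i}"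
    unfolding bij_betw_def
  proof
    show "inj_on ?g crossings"
    proof (rule inj_onI)
      fix b b' assume b: "b \<in> crossings" "b' \<in> crossings" and "?g b = ?g b'"
      then have "(b mod n, b' mod n) \<in> linked" by blast
      with b show "b = b'" by (rule crossings_inj)
    qed
    show "?g ` crossings = {C \<in> quiver_components {..<n} arrows. \<exists>i\<in>C. returns i}"
    proof (intro equalityI subsetI)
      fix C assume "C \<in> ?g ` crossings"
      then obtain b where b: "b \<in> crossings" and C: "C = ?g b" by blast
      have "C \<in> quiver_components {..<n} arrows"
        unfolding C quiver_components_def using n_pos by (intro quotientI) simp
      moreover have "returns (b mod n)" using b by (simp add: crossings_def returns_mod)
      moreover have "b mod n \<in> C" unfolding C by simp
      ultimately show "C \<in> {C \<in> quiver_components {..<n} arrows. \<exists>i\<in>C. returns i}" by blast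
    next
      fix C assume "C \<in> {C \<in> quiver_components {..<n} arrows. \<exists>i\<in>C. returns i}"
      then obtain i0 i where i0: "i0 < n" "C = linked `` {i0}" and i: "(i0, i) \<in> linked" "returns i"
        by (auto simp: quiver_components_def quotient_def)
      obtain b where b: "b \<in> crossings" "(i, b mod n) \<in> linked"
        using crossing_exists[OF linked_less[OF i(1) i0(1)] i(2)] .
      have ib: "(i0, b mod n) \<in> linked" using i(1) b(2) by (rule rtrancl_trans)
      have "C = ?g b" unfolding i0(2)
        using ib linked_sym[OF ib] by (auto intro: rtrancl_trans)
      with b show "C \<in> ?g ` crossings" by blast
    qed
  qed
  then show ?thesis by (simp add: bij_betw_same_card)
qed

text \<open>
  The weight is a parameter since the length of \<open>P\<^sub>i\<close> is known only at vertices of the quiver; it has to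
  agree with the displacement only on actual cycles.
\<close>

lemma card_weight_one_components:
  fixes weight :: "nat list \<Rightarrow> rat"
  assumes weight: "\<And>c. oriented_cycle arrows c \<Longrightarrow> weight c = (\<Sum>i\<leftarrow>c. of_nat (f i - i)) / of_nat n"
  shows "card {C \<in> quiver_components {..<n} arrows.
    weight (SOME c. oriented_cycle arrows c \<and> set c \<subseteq> C) = 1} = card crossings"
proof -
  have "weight (SOME c. oriented_cycle arrows c \<and> set c \<subseteq> C) = 1 \<longleftrightarrow> (\<exists>i\<in>C. returns i)"
    if C: "C \<in> quiver_components {..<n} arrows" for C
  proof -
    obtain i0 where i0: "i0 < n" "C = linked `` {i0}"
      using C unfolding quiver_components_def quotient_def by blast
    define c where "c = (SOME c. oriented_cycle arrows c \<and> set c \<subseteq> C)"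
    obtain d where "oriented_cycle arrows d" "\<And>j. j \<in> set d \<Longrightarrow> (i0, j) \<in> linked"
      using oriented_cycle_exists[OF i0(1)] by blast
    then have "oriented_cycle arrows d \<and> set d \<subseteq> C" using i0 by auto
    then have c: "oriented_cycle arrows c \<and> set c \<subseteq> C" unfolding c_def by (rule someI)
    then have "weight c = (\<Sum>i\<leftarrow>c. of_nat (f i - i)) / of_nat n" by (intro weight) simp
    also have "\<dots> = of_nat (\<Sum>i\<leftarrow>c. f i - i) / of_nat n"
      by (induction c) (simp_all add: add_divide_distrib)
    finally have "weight c = 1 \<longleftrightarrow> (of_nat (\<Sum>i\<leftarrow>c. f i - i) :: rat) = of_nat n"
      using n_pos by (simp add: divide_eq_eq)
    also have "\<dots> \<longleftrightarrow> (\<Sum>i\<leftarrow>c. f i - i) = n" by (rule of_nat_eq_iff)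
    also have "\<dots> \<longleftrightarrow> (\<exists>i\<in>C. returns i)"
      using oriented_cycle_weight[of c i0] c i0 by blast
    finally show ?thesis unfolding c_def .
  qed
  then have "{C \<in> quiver_components {..<n} arrows.
      weight (SOME c. oriented_cycle arrows c \<and> set c \<subseteq> C) = 1} =
      {C \<in> quiver_components {..<n} arrows. \<exists>i\<in>C. returns i}" by blast
  then show ?thesis by (simp add: card_returning_components)
qed

end

section \<open>The path algebra and the ideal of relations\<close>

definition path_term :: "path \<Rightarrow> 'k \<Rightarrow> path \<Rightarrow> 'k::field" where
  "path_term p c = (\<lambda>q. if q = p then c else 0)"

locale nakayama =
  fixes K :: "'k::field itself" and n :: nat and Y :: "path set"
  assumes relations: "cyclic_nakayama_relations n Y"
begin

abbreviation PA :: "(path \<Rightarrow> 'k) ring" where "PA \<equiv> path_algebra n"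
abbreviation I :: "(path \<Rightarrow> 'k) set" where "I \<equiv> relation_ideal n Y"
abbreviation A :: "(path \<Rightarrow> 'k) set ring" where "A \<equiv> nakayama_algebra n Y"
abbreviation P :: "nat \<Rightarrow> ((path \<Rightarrow> 'k) set, (path \<Rightarrow> 'k) set) module" where
  "P \<equiv> projective_module K n Y"

text \<open>
  These are the paths that vanish in the Nakayama algebra.
\<close>

definition dead :: "nat \<Rightarrow> nat \<Rightarrow> bool" where
  "dead i L \<longleftrightarrow> (\<exists>a l k. (a, l) \<in> Y \<and> k + l \<le> L \<and> (i + k) mod n = a)"

text \<open>
  It turns out to be the length of \<open>P\<^sub>i\<close>.
\<close>

definition len :: "nat \<Rightarrow> nat" where
  "len i = (LEAST L. dead i L)"

lemma n_pos: "0 < n" and relation_start: "(a, l) \<in> Y \<Longrightarrow> a < n"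
  and relation_length: "(a, l) \<in> Y \<Longrightarrow> 2 \<le> l" and relations_nonempty: "Y \<noteq> {}"
  using relations unfolding cyclic_nakayama_relations_def nakayama_relations_def by auto

lemma dead_mono: "dead i L \<Longrightarrow> L \<le> L' \<Longrightarrow> dead i L'"
  unfolding dead_def using le_trans by blast

lemma dead_suffix: "dead ((i + k) mod n) L \<Longrightarrow> dead i (k + L)"
proof -
  assume "dead ((i + k) mod n) L"
  then obtain a l j where *: "(a, l) \<in> Y" "j + l \<le> L" "((i + k) mod n + j) mod n = a"
    unfolding dead_def by blast
  then have "(k + j) + l \<le> k + L" "(i + (k + j)) mod n = a"
    by (simp_all add: mod_add_left_eq add.assoc)
  with *(1) show "dead i (k + L)" unfolding dead_def by blast
qed

lemma dead_exists: "\<exists>L. dead i L"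
proof -
  obtain a l where al: "(a, l) \<in> Y" using relations_nonempty by auto
  have a: "a < n" using relation_start[OF al] .
  have "i \<le> n * i" using n_pos by simp
  then have "i + (n * i - i + a) = a + n * i" by linarith
  then have "(i + (n * i - i + a)) mod n = a" using a by simp
  with al show ?thesis unfolding dead_def by (intro exI) (rule conjI, assumption, rule conjI, rule order_refl, assumption)
qed

lemma dead_iff: "dead i L \<longleftrightarrow> len i \<le> L"
proof
  assume "dead i L" then show "len i \<le> L" unfolding len_def by (rule Least_le)
next
  have "dead i (len i)" unfolding len_def using dead_exists by (rule LeastI_ex)
  then show "len i \<le> L \<Longrightarrow> dead i L" by (rule dead_mono)
qed

lemma len_ge_2: "2 \<le> len i"
proof -
  have "dead i (len i)" by (simp add: dead_iff)
  then show ?thesis unfolding dead_def using relation_length by fastforce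
qed

lemma PA_carrier: "x \<in> carrier PA \<longleftrightarrow> finite {q. x q \<noteq> 0} \<and> (\<forall>i l. x (i, l) \<noteq> 0 \<longrightarrow> i < n)"
  by (simp add: path_algebra_def)

lemma PA_simps:
  "(x \<otimes>\<^bsub>PA\<^esub> y) (i, l) = (\<Sum>k\<le>l. x (i, k) * y ((i + k) mod n, l - k))"
  "(x \<oplus>\<^bsub>PA\<^esub> y) q = x q + y q"
  "\<zero>\<^bsub>PA\<^esub> q = 0"
  "\<one>\<^bsub>PA\<^esub> (i, l) = (if i < n \<and> l = 0 then 1 else 0)"
  by (simp_all add: path_algebra_def)

lemma PA_mult_closed:
  assumes x: "x \<in> carrier PA" and y: "y \<in> carrier PA"
  shows "x \<otimes>\<^bsub>PA\<^esub> y \<in> carrier PA"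
proof -
  let ?X = "{q. x q \<noteq> 0}" and ?Z = "{q. y q \<noteq> 0}"
  have fin: "finite ?X" "finite ?Z" using x y by (simp_all add: PA_carrier)
  have sub: "\<exists>k\<le>l. (i, k) \<in> ?X \<and> ((i + k) mod n, l - k) \<in> ?Z" if "(x \<otimes>\<^bsub>PA\<^esub> y) (i, l) \<noteq> 0" for i l
  proof (rule ccontr)
    assume "\<not> ?thesis"
    then have "(x \<otimes>\<^bsub>PA\<^esub> y) (i, l) = 0" unfolding PA_simps by (intro sum.neutral) auto
    with that show False by simp
  qed
  have "{q. (x \<otimes>\<^bsub>PA\<^esub> y) q \<noteq> 0} \<subseteq> (\<lambda>(q, r). (fst q, snd q + snd r)) ` (?X \<times> ?Z)"
  proof
    fix q assume "q \<in> {q. (x \<otimes>\<^bsub>PA\<^esub> y) q \<noteq> 0}"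
    then obtain i l where q: "q = (i, l)" "(x \<otimes>\<^bsub>PA\<^esub> y) (i, l) \<noteq> 0" by (cases q) auto
    then obtain k where k: "k \<le> l" "(i, k) \<in> ?X" "((i + k) mod n, l - k) \<in> ?Z" using sub by blast
    have "q = (\<lambda>(q, r). (fst q, snd q + snd r)) ((i, k), ((i + k) mod n, l - k))"
      using k(1) q by simp
    with k show "q \<in> (\<lambda>(q, r). (fst q, snd q + snd r)) ` (?X \<times> ?Z)" by blast
  qed
  then have "finite {q. (x \<otimes>\<^bsub>PA\<^esub> y) q \<noteq> 0}" using fin by (rule finite_subset[OF _ finite_imageI[OF finite_cartesian_product]])
  moreover have "i < n" if "(x \<otimes>\<^bsub>PA\<^esub> y) (i, l) \<noteq> 0" for i l
    using sub[OF that] x by (auto simp: PA_carrier)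
  ultimately show ?thesis by (simp only: PA_carrier) blast
qed

text \<open>
  Both sides sum over the factorisations of a path into three consecutive pieces.
\<close>

lemma PA_assoc: "(x \<otimes>\<^bsub>PA\<^esub> y) \<otimes>\<^bsub>PA\<^esub> z = x \<otimes>\<^bsub>PA\<^esub> (y \<otimes>\<^bsub>PA\<^esub> z)"
proof (rule ext, clarify)
  fix i l
  let ?t = "\<lambda>j k. x (i, j) * y ((i + j) mod n, k - j) * z ((i + k) mod n, l - k)"
  have "((x \<otimes>\<^bsub>PA\<^esub> y) \<otimes>\<^bsub>PA\<^esub> z) (i, l) = (\<Sum>k\<le>l. \<Sum>j\<le>k. ?t j k)"
    by (simp add: PA_simps sum_distrib_right)
  also have "\<dots> = (\<Sum>(k, j)\<in>Sigma {..l} (\<lambda>k. {..k}). ?t j k)" by (simp add: sum.Sigma)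
  also have "\<dots> = (\<Sum>(j, k)\<in>Sigma {..l} (\<lambda>j. {j..l}). ?t j k)"
    by (rule sum.reindex_bij_witness[of _ "\<lambda>(j, k). (k, j)" "\<lambda>(k, j). (j, k)"]) auto
  also have "\<dots> = (\<Sum>j\<le>l. \<Sum>k\<in>{j..l}. ?t j k)" by (simp add: sum.Sigma)
  also have "\<dots> = (\<Sum>j\<le>l. \<Sum>m\<le>l - j. ?t j (j + m))"
  proof (rule sum.cong[OF refl])
    fix j
    show "(\<Sum>k\<in>{j..l}. ?t j k) = (\<Sum>m\<le>l - j. ?t j (j + m))" if "j \<in> {..l}"
      by (rule sum.reindex_bij_witness[of _ "\<lambda>m. j + m" "\<lambda>k. k - j"]) (use that in auto)
  qed
  also have "\<dots> = (x \<otimes>\<^bsub>PA\<^esub> (y \<otimes>\<^bsub>PA\<^esub> z)) (i, l)"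
    by (simp add: PA_simps sum_distrib_left mult.assoc mod_add_left_eq add.assoc)
  finally show "((x \<otimes>\<^bsub>PA\<^esub> y) \<otimes>\<^bsub>PA\<^esub> z) (i, l) = (x \<otimes>\<^bsub>PA\<^esub> (y \<otimes>\<^bsub>PA\<^esub> z)) (i, l)" .
qed

lemma PA_add_closed:
  assumes "x \<in> carrier PA" "y \<in> carrier PA" shows "x \<oplus>\<^bsub>PA\<^esub> y \<in> carrier PA"
proof -
  have "{q. (x \<oplus>\<^bsub>PA\<^esub> y) q \<noteq> 0} \<subseteq> {q. x q \<noteq> 0} \<union> {q. y q \<noteq> 0}" by (auto simp: PA_simps)
  then have "finite {q. (x \<oplus>\<^bsub>PA\<^esub> y) q \<noteq> 0}"
    using assms by (rule_tac finite_subset) (auto simp: PA_carrier)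
  moreover have "i < n" if "(x \<oplus>\<^bsub>PA\<^esub> y) (i, l) \<noteq> 0" for i l
    using that assms by (cases "x (i, l) = 0") (auto simp: PA_carrier PA_simps)
  ultimately show ?thesis by (simp only: PA_carrier) blast
qed

lemma PA_uminus_closed: "x \<in> carrier PA \<Longrightarrow> (\<lambda>q. - x q) \<in> carrier PA"
  by (simp add: PA_carrier)

lemma PA_ring: "ring PA"
proof (rule ringI)
  show "abelian_group PA"
  proof (rule abelian_groupI)
    fix x :: "path \<Rightarrow> 'k" assume x: "x \<in> carrier PA"
    show "\<exists>y\<in>carrier PA. y \<oplus>\<^bsub>PA\<^esub> x = \<zero>\<^bsub>PA\<^esub>"
      by (rule bexI[OF _ PA_uminus_closed[OF x]]) (rule ext, simp add: PA_simps)
  next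
    show "\<zero>\<^bsub>PA\<^esub> \<in> carrier PA" by (simp add: PA_carrier PA_simps)
  qed (simp_all add: PA_add_closed PA_simps fun_eq_iff add.assoc add.commute)
  have one: "\<one>\<^bsub>PA\<^esub> \<in> carrier PA"
  proof -
    have "{q. \<one>\<^bsub>PA\<^esub> q \<noteq> (0::'k)} \<subseteq> {..<n} \<times> {0}" by (auto simp: PA_simps split: if_splits)
    then have "finite {q. \<one>\<^bsub>PA\<^esub> q \<noteq> (0::'k)}" by (rule finite_subset) simp
    moreover have "i < n" if "\<one>\<^bsub>PA\<^esub> (i, l) \<noteq> (0::'k)" for i l
      using that by (simp add: PA_simps split: if_splits)
    ultimately show ?thesis by (simp only: PA_carrier) blast
  qed
  show "Group.monoid PA"
  proof (rule monoidI)
    fix x assume x: "x \<in> carrier PA"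
    then have out: "x (i, l) = 0" if "\<not> i < n" for i l using that by (auto simp: PA_carrier)
    show "\<one>\<^bsub>PA\<^esub> \<otimes>\<^bsub>PA\<^esub> x = x"
    proof (rule ext, clarify)
      fix i l
      have "(\<one>\<^bsub>PA\<^esub> \<otimes>\<^bsub>PA\<^esub> x) (i, l) = (\<Sum>k\<le>l. if k = 0 then (if i < n then x (i mod n, l) else 0) else 0)"
        unfolding PA_simps by (intro sum.cong) auto
      then show "(\<one>\<^bsub>PA\<^esub> \<otimes>\<^bsub>PA\<^esub> x) (i, l) = x (i, l)" by (simp add: out)
    qed
    show "x \<otimes>\<^bsub>PA\<^esub> \<one>\<^bsub>PA\<^esub> = x"
    proof (rule ext, clarify)
      fix i l
      have "(x \<otimes>\<^bsub>PA\<^esub> \<one>\<^bsub>PA\<^esub>) (i, l) = (\<Sum>k\<le>l. if k = l then x (i, l) else 0)"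
        unfolding PA_simps using n_pos by (intro sum.cong) auto
      then show "(x \<otimes>\<^bsub>PA\<^esub> \<one>\<^bsub>PA\<^esub>) (i, l) = x (i, l)" by simp
    qed
  qed (simp_all add: PA_mult_closed PA_assoc one)
qed (simp_all add: PA_simps fun_eq_iff ring_distribs sum.distrib)

end

sublocale nakayama \<subseteq> PA: ring "path_algebra n :: (path \<Rightarrow> 'k) ring"
  by (rule PA_ring)

context nakayama
begin

lemma PA_minus: "x \<in> carrier PA \<Longrightarrow> \<ominus>\<^bsub>PA\<^esub> x = (\<lambda>q. - x q)"
  by (rule PA.minus_equality) (simp_all add: PA_uminus_closed fun_eq_iff PA_simps)

lemma term_closed: "i < n \<Longrightarrow> path_term (i, l) c \<in> carrier PA"
proof -
  assume "i < n"
  moreover have "{q. path_term (i, l) c q \<noteq> 0} \<subseteq> {(i, l)}" by (auto simp: path_term_def split: if_splits)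
  then have "finite {q. path_term (i, l) c q \<noteq> 0}" by (rule finite_subset) simp
  ultimately show ?thesis unfolding PA_carrier by (auto simp: path_term_def split: if_splits)
qed

lemma term_mult:
  "(path_term (i, k) c \<otimes>\<^bsub>PA\<^esub> y) (j, l) = (if j = i \<and> k \<le> l then c * y ((i + k) mod n, l - k) else 0)"
proof -
  have "(path_term (i, k) c \<otimes>\<^bsub>PA\<^esub> y) (j, l) =
      (\<Sum>m\<le>l. if m = k then (if j = i then c * y ((i + k) mod n, l - k) else 0) else 0)"
    unfolding PA_simps path_term_def by (intro sum.cong) auto
  then show ?thesis by simp
qed

lemma term_mult_term:
  "path_term (i, k) c \<otimes>\<^bsub>PA\<^esub> path_term ((i + k) mod n, l) d = path_term (i, k + l) (c * d)"
  by (rule ext, clarify, simp only: term_mult, auto simp: path_term_def)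

definition dead_span :: "(path \<Rightarrow> 'k) set" where
  "dead_span = {x \<in> carrier PA. \<forall>i l. x (i, l) \<noteq> 0 \<longrightarrow> dead i l}"

lemma dead_span_ideal: "ideal dead_span PA"
proof (rule idealI[OF PA_ring])
  show "subgroup dead_span (add_monoid PA)"
  proof (rule PA.add.subgroupI)
    show "dead_span \<noteq> {}" using PA.zero_closed by (auto simp: dead_span_def PA_simps intro!: exI[of _ "\<zero>\<^bsub>PA\<^esub>"])
    fix x assume x: "x \<in> dead_span"
    show "\<ominus>\<^bsub>PA\<^esub> x \<in> dead_span" using x by (simp add: dead_span_def PA_minus PA_uminus_closed)
    fix y assume y: "y \<in> dead_span"
    have "x (i, l) \<noteq> 0 \<or> y (i, l) \<noteq> 0" if "(x \<oplus>\<^bsub>PA\<^esub> y) (i, l) \<noteq> 0" for i l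
      using that by (auto simp: PA_simps)
    with x y show "x \<oplus>\<^bsub>PA\<^esub> y \<in> dead_span" unfolding dead_span_def by (simp add: PA_add_closed) blast
  qed (auto simp: dead_span_def)
  fix a x assume a: "a \<in> dead_span" and x: "x \<in> carrier PA"
  have ac: "a \<in> carrier PA" using a by (simp add: dead_span_def)
  show "x \<otimes>\<^bsub>PA\<^esub> a \<in> dead_span"
  proof -
    have "dead i l" if "(x \<otimes>\<^bsub>PA\<^esub> a) (i, l) \<noteq> 0" for i l
    proof (rule ccontr)
      assume nd: "\<not> dead i l"
      have "a ((i + k) mod n, l - k) = 0" if "k \<le> l" for k
        using a dead_suffix[of i k "l - k"] that nd by (auto simp: dead_span_def)
      then have "(x \<otimes>\<^bsub>PA\<^esub> a) (i, l) = 0" unfolding PA_simps by (intro sum.neutral) simp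
      with that show False by simp
    qed
    then show ?thesis using x ac by (simp add: dead_span_def)
  qed
  show "a \<otimes>\<^bsub>PA\<^esub> x \<in> dead_span"
  proof -
    have "dead i l" if "(a \<otimes>\<^bsub>PA\<^esub> x) (i, l) \<noteq> 0" for i l
    proof (rule ccontr)
      assume nd: "\<not> dead i l"
      have "a (i, k) = 0" if "k \<le> l" for k
        using a dead_mono[of i k l] that nd by (auto simp: dead_span_def)
      then have "(a \<otimes>\<^bsub>PA\<^esub> x) (i, l) = 0" unfolding PA_simps by (intro sum.neutral) simp
      with that show False by simp
    qed
    then show ?thesis using x ac by (simp add: dead_span_def)
  qed
qed

lemma path_elem_eq_term: "path_elem q = path_term q 1"
  by (simp add: path_elem_def path_term_def)

lemma dead_term_in_ideal:
  assumes J: "ideal J PA" "path_elem ` Y \<subseteq> J" and i: "i < n" and d: "dead i l"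
  shows "path_term (i, l) c \<in> J"
proof -
  interpret J: ideal J PA by fact
  obtain m k where y: "((i + k) mod n, m) \<in> Y" "k + m \<le> l" using d unfolding dead_def by blast
  have "path_term ((i + k) mod n, m) 1 \<in> J" using J(2) y(1) by (auto simp: path_elem_eq_term)
  then have "path_term (i, k) c \<otimes>\<^bsub>PA\<^esub> path_term ((i + k) mod n, m) 1 \<otimes>\<^bsub>PA\<^esub>
      path_term ((i + (k + m)) mod n, l - (k + m)) 1 \<in> J"
    using i n_pos by (intro J.I_r_closed J.I_l_closed term_closed) simp_all
  then show ?thesis
    unfolding term_mult_term using y(2) by simp
qed

text \<open>
  Elements supported on vanishing paths form an ideal, because a path with a vanishing factor vanishes.
  Conversely each vanishing path is a multiple of a relation, and an element is a finite sum of multiples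
  of paths.
\<close>

lemma relation_ideal_eq: "I = dead_span"
proof
  have "path_elem ` Y \<subseteq> dead_span"
  proof (rule image_subsetI)
    fix y assume y: "y \<in> Y"
    obtain a l where al: "y = (a, l)" by (cases y)
    have "a < n" using relation_start[of a l] y al by simp
    moreover have "dead a l" unfolding dead_def using y \<open>a < n\<close> unfolding al by (intro exI[of _ a] exI[of _ l] exI[of _ 0]) simp
    ultimately show "path_elem y \<in> dead_span"
      using term_closed[of a l 1] unfolding al path_elem_eq_term dead_span_def by (auto simp: path_term_def)
  qed
  then show "I \<subseteq> dead_span"
    unfolding relation_ideal_def by (rule PA.genideal_minimal[OF dead_span_ideal])
  show "dead_span \<subseteq> I"
    unfolding relation_ideal_def genideal_def
  proof (intro Inter_greatest subsetI)
    fix J x assume "J \<in> {J. ideal J PA \<and> path_elem ` Y \<subseteq> J}" and x: "x \<in> dead_span"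
    then have J: "ideal J PA" "path_elem ` Y \<subseteq> J" by simp_all
    interpret J: ideal J PA by fact
    have "x \<in> J" if "finite F" "{q. x q \<noteq> 0} \<subseteq> F" "x \<in> dead_span" for F x
      using that
    proof (induction F arbitrary: x rule: finite_induct)
      case empty
      then have "x = \<zero>\<^bsub>PA\<^esub>" by (auto simp: fun_eq_iff PA_simps)
      then show ?case by simp
    next
      case (insert q F)
      obtain i l where q: "q = (i, l)" by (cases q)
      show ?case
      proof (cases "x q = 0")
        case True
        with insert.prems(1) have "{q. x q \<noteq> 0} \<subseteq> F" by auto
        then show ?thesis using insert by blast
      next
        case False
        let ?x = "x(q := 0)"
        have "finite {r. ?x r \<noteq> 0}"
          by (rule finite_subset[of _ "{r. x r \<noteq> 0}"]) (use insert.prems(2) in \<open>auto simp: dead_span_def PA_carrier\<close>)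
        then have "?x \<in> dead_span" using insert.prems(2) unfolding dead_span_def PA_carrier by auto
        moreover have "{r. ?x r \<noteq> 0} \<subseteq> F" using insert.prems(1) by auto
        ultimately have "?x \<in> J" by (intro insert.IH)
        moreover have "i < n" "dead i l" using insert.prems(2) False unfolding q dead_span_def PA_carrier by auto
        then have "path_term q (x q) \<in> J" unfolding q by (intro dead_term_in_ideal[OF J])
        ultimately have "?x \<oplus>\<^bsub>PA\<^esub> path_term q (x q) \<in> J" by (rule J.a_closed)
        moreover have "?x \<oplus>\<^bsub>PA\<^esub> path_term q (x q) = x" by (auto simp: fun_eq_iff PA_simps path_term_def)
        ultimately show ?thesis by simp
      qed
    qed
    then show "x \<in> J" using x by (auto simp: dead_span_def PA_carrier)
  qed
qed

end

sublocale nakayama \<subseteq> I: ideal "relation_ideal n Y :: (path \<Rightarrow> 'k) set" "path_algebra n"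
  using dead_span_ideal relation_ideal_eq by simp

section \<open>Submodules, length and socle of the projective modules\<close>

context nakayama
begin

definition cls :: "(path \<Rightarrow> 'k) \<Rightarrow> (path \<Rightarrow> 'k) set" where
  "cls x = I +>\<^bsub>PA\<^esub> x"

text \<open>
  The paths without relations are a basis of the quotient.
\<close>

lemma cls_eq_iff:
  assumes "x \<in> carrier PA" "y \<in> carrier PA"
  shows "cls x = cls y \<longleftrightarrow> (\<forall>i l. \<not> dead i l \<longrightarrow> x (i, l) = y (i, l))"
proof -
  have "x \<ominus>\<^bsub>PA\<^esub> y \<in> carrier PA" using assms by simp
  moreover have "(x \<ominus>\<^bsub>PA\<^esub> y) q = x q - y q" for q
    using assms by (simp add: a_minus_def PA_minus PA_simps)
  ultimately have "x \<ominus>\<^bsub>PA\<^esub> y \<in> I \<longleftrightarrow> (\<forall>i l. \<not> dead i l \<longrightarrow> x (i, l) = y (i, l))"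
    unfolding relation_ideal_eq dead_span_def by auto
  then show ?thesis
    unfolding cls_def using PA.quotient_eq_iff_same_a_r_cos[OF I.is_ideal assms] by simp
qed

lemma A_carrier: "carrier A = cls ` carrier PA"
  unfolding nakayama_algebra_def FactRing_def A_RCOSETS_def' cls_def by auto

lemma A_mult: "x \<in> carrier PA \<Longrightarrow> y \<in> carrier PA \<Longrightarrow> cls x \<otimes>\<^bsub>A\<^esub> cls y = cls (x \<otimes>\<^bsub>PA\<^esub> y)"
  by (simp add: nakayama_algebra_def FactRing_def cls_def I.rcoset_mult_add)

lemma A_add: "x \<in> carrier PA \<Longrightarrow> y \<in> carrier PA \<Longrightarrow> cls x \<oplus>\<^bsub>A\<^esub> cls y = cls (x \<oplus>\<^bsub>PA\<^esub> y)"
  by (simp add: nakayama_algebra_def FactRing_def cls_def I.a_rcos_sum)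

lemma A_zero: "\<zero>\<^bsub>A\<^esub> = cls \<zero>\<^bsub>PA\<^esub>"
  using PA.a_coset_add_zero[OF I.a_subset] by (simp add: nakayama_algebra_def FactRing_def cls_def)

text \<open>
  The linear combination of the surviving paths from \<open>i\<close> with coefficients \<open>m\<close>; it is cut off at \<open>len i\<close>
  so that its support is finite for arbitrary \<open>m\<close>.
\<close>

definition vec :: "nat \<Rightarrow> (nat \<Rightarrow> 'k) \<Rightarrow> path \<Rightarrow> 'k" where
  "vec i m = (\<lambda>(a, l). if a = i \<and> l < len i then m l else 0)"

definition elt :: "nat \<Rightarrow> (nat \<Rightarrow> 'k) \<Rightarrow> (path \<Rightarrow> 'k) set" where
  "elt i m = cls (vec i m)"

lemma vec_closed: "i < n \<Longrightarrow> vec i m \<in> carrier PA"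
proof -
  assume "i < n"
  moreover have "{q. vec i m q \<noteq> 0} \<subseteq> {i} \<times> {..<len i}" by (auto simp: vec_def split: if_splits)
  then have "finite {q. vec i m q \<noteq> 0}" by (rule finite_subset) simp
  ultimately show ?thesis unfolding PA_carrier by (auto simp: vec_def split: if_splits)
qed

lemma elt_eq_iff: "i < n \<Longrightarrow> elt i m = elt i m' \<longleftrightarrow> (\<forall>l<len i. m l = m' l)"
  unfolding elt_def by (subst cls_eq_iff) (simp_all add: vec_closed dead_iff, auto simp: vec_def)

lemma P_carrier: "i < n \<Longrightarrow> carrier (P i) = range (elt i)"
proof -
  assume i: "i < n"
  have idem: "vertex_idempotent n Y i = cls (path_term (i, 0) 1)"
    by (simp add: vertex_idempotent_def cls_def path_elem_eq_term)
  have proj: "cls (path_term (i, 0) 1) \<otimes>\<^bsub>A\<^esub> cls x = elt i (\<lambda>l. x (i, l))" if x: "x \<in> carrier PA" for x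
    unfolding elt_def using i x
    by (subst A_mult, simp_all add: term_closed, subst cls_eq_iff)
      (simp_all add: term_closed vec_closed dead_iff, auto simp: term_mult vec_def)
  have "elt i m = elt i (\<lambda>l. vec i m (i, l))" for m
    using i by (simp add: elt_eq_iff vec_def)
  then have *: "elt i m = cls (path_term (i, 0) 1) \<otimes>\<^bsub>A\<^esub> cls (vec i m)" for m
    using proj[OF vec_closed[OF i]] by metis
  then show ?thesis
  proof (intro equalityI subsetI)
    fix x assume "x \<in> carrier (P i)"
    then obtain a where a: "x = cls (path_term (i, 0) 1) \<otimes>\<^bsub>A\<^esub> a" "a \<in> carrier A"
      by (auto simp: projective_module_def Let_def idem)
    then show "x \<in> range (elt i)" unfolding A_carrier using proj by blast
  next
    fix x assume "x \<in> range (elt i)"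
    then obtain m where "x = elt i m" by blast
    with * vec_closed[OF i] show "x \<in> carrier (P i)"
      unfolding projective_module_def Let_def idem A_carrier by auto
  qed
qed

lemma P_zero: "i < n \<Longrightarrow> \<zero>\<^bsub>P i\<^esub> = elt i (\<lambda>_. 0)"
  unfolding projective_module_def Let_def elt_def
  by (simp add: A_zero cls_eq_iff vec_closed) (simp add: vec_def PA_simps)

lemma P_add: "i < n \<Longrightarrow> elt i m \<oplus>\<^bsub>P i\<^esub> elt i m' = elt i (\<lambda>l. m l + m' l)"
  unfolding projective_module_def Let_def elt_def
  by (simp add: A_add vec_closed cls_eq_iff) (simp add: vec_def PA_simps)

lemma P_smult:
  assumes i: "i < n" and r: "r \<in> carrier PA"
  shows "cls r \<odot>\<^bsub>P i\<^esub> elt i m = elt i (\<lambda>l. \<Sum>k\<le>l. m k * r ((i + k) mod n, l - k))"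
proof -
  have "(vec i m \<otimes>\<^bsub>PA\<^esub> r) (a, l) = vec i (\<lambda>l. \<Sum>k\<le>l. m k * r ((i + k) mod n, l - k)) (a, l)"
    if "\<not> dead a l" for a l
  proof (cases "a = i")
    case True
    then have "k < len i" if "k \<le> l" for k using \<open>\<not> dead a l\<close> that by (simp add: dead_iff)
    then show ?thesis using True by (simp add: PA_simps vec_def)
  qed (simp add: PA_simps vec_def)
  then have "cls (vec i m \<otimes>\<^bsub>PA\<^esub> r) = elt i (\<lambda>l. \<Sum>k\<le>l. m k * r ((i + k) mod n, l - k))"
    unfolding elt_def using i r by (subst cls_eq_iff) (simp_all add: vec_closed)
  moreover have "cls r \<odot>\<^bsub>P i\<^esub> elt i m = cls (vec i m) \<otimes>\<^bsub>A\<^esub> cls r"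
    unfolding elt_def by (simp add: projective_module_def Let_def)
  ultimately show ?thesis using i r by (simp add: A_mult vec_closed)
qed

lemma P_abelian_group: "i < n \<Longrightarrow> abelian_group (P i)"
proof (rule abelian_groupI)
  assume i: "i < n"
  fix x assume "x \<in> carrier (P i)"
  then obtain m where "x = elt i m" using P_carrier[OF i] by auto
  then show "\<exists>y\<in>carrier (P i). y \<oplus>\<^bsub>P i\<^esub> x = \<zero>\<^bsub>P i\<^esub>"
    using i by (intro bexI[of _ "elt i (\<lambda>l. - m l)"]) (simp_all add: P_add P_zero P_carrier)
qed (auto simp: P_carrier P_zero P_add add.assoc add.commute add.left_commute)

text \<open>
  The span of the paths of length at least \<open>k\<close>: the members of the composition series of \<open>P\<^sub>i\<close>.
\<close>

definition tail :: "nat \<Rightarrow> nat \<Rightarrow> (path \<Rightarrow> 'k) set set" where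
  "tail i k = elt i ` {m. \<forall>l<k. m l = 0}"

lemma elt_in_tail: "i < n \<Longrightarrow> k \<le> len i \<Longrightarrow> elt i m \<in> tail i k \<longleftrightarrow> (\<forall>l<k. m l = 0)"
  unfolding tail_def image_iff by (auto simp: elt_eq_iff)

lemma tail_strict: "i < n \<Longrightarrow> j < k \<Longrightarrow> k \<le> len i \<Longrightarrow> tail i k \<subset> tail i j"
proof -
  assume *: "i < n" "j < k" "k \<le> len i"
  have "tail i k \<subseteq> tail i j" unfolding tail_def using * by auto
  moreover have "elt i (\<lambda>l. if l = j then 1 else 0) \<in> tail i j - tail i k"
    using * by (auto simp: elt_in_tail)
  ultimately show ?thesis by blast
qed

lemma tail_full: "i < n \<Longrightarrow> tail i (len i) = {\<zero>\<^bsub>P i\<^esub>}"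
proof -
  assume i: "i < n"
  have "elt i m = elt i (\<lambda>_. 0)" if "\<forall>l<len i. m l = 0" for m
    using that i by (simp add: elt_eq_iff)
  then show ?thesis unfolding tail_def P_zero[OF i] by blast
qed

lemma tail_submodule:
  assumes i: "i < n" shows "submodule (tail i k) A (P i)"
proof -
  interpret P: abelian_group "P i" using i by (rule P_abelian_group)
  have "subgroup (tail i k) (add_monoid (P i))"
  proof (rule P.add.subgroupI)
    fix x assume "x \<in> tail i k"
    then obtain m where m: "x = elt i m" "\<forall>l<k. m l = 0" by (auto simp: tail_def)
    have "\<ominus>\<^bsub>P i\<^esub> x = elt i (\<lambda>l. - m l)"
      unfolding m(1) using i by (intro P.minus_equality) (simp_all add: P_add P_zero P_carrier)
    then show "\<ominus>\<^bsub>P i\<^esub> x \<in> tail i k" using m(2) by (auto simp: tail_def)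
    fix y assume "y \<in> tail i k"
    then obtain m' where m': "y = elt i m'" "\<forall>l<k. m' l = 0" by (auto simp: tail_def)
    show "x \<oplus>\<^bsub>P i\<^esub> y \<in> tail i k" using m m' i by (auto simp: tail_def P_add)
  qed (use i in \<open>auto simp: tail_def P_carrier\<close>)
  moreover have "a \<odot>\<^bsub>P i\<^esub> x \<in> tail i k" if a: "a \<in> carrier A" and x: "x \<in> tail i k" for a x
  proof -
    obtain r where r: "a = cls r" "r \<in> carrier PA" using a by (auto simp: A_carrier)
    obtain m where m: "x = elt i m" "\<forall>l<k. m l = 0" using x by (auto simp: tail_def)
    show ?thesis unfolding r(1) m(1) P_smult[OF i r(2)] tail_def using m(2) by (intro imageI) simp
  qed
  ultimately show ?thesis by (intro submodule.intro submodule_axioms.intro)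
qed

text \<open>
  Let \<open>k\<close> be the least length of a path occurring in an element of \<open>H\<close>. By downward induction on \<open>j\<close>, an element \<open>t\<close> of \<open>tail i j\<close> is in \<open>H\<close>: extending an element with leading term at \<open>k\<close> by a path of
  length \<open>j - k\<close> and scaling gives an element of \<open>H\<close> with the same leading term as \<open>t\<close>.
\<close>

lemma submodule_is_tail:
  assumes i: "i < n" and H: "submodule H A (P i)"
  obtains k where "k \<le> len i" "H = tail i k"
proof -
  interpret H: submodule H A "P i" by (rule H)
  have sub: "H \<subseteq> range (elt i)" using H.subset P_carrier[OF i] by simp
  have zero: "elt i (\<lambda>_. 0) \<in> H" using H.one_closed P_zero[OF i] by simp
  have add: "elt i (\<lambda>l. m l + m' l) \<in> H" if "elt i m \<in> H" "elt i m' \<in> H" for m m'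
    using H.m_closed[OF that] P_add[OF i] by simp
  let ?Q = "\<lambda>k. k < len i \<and> (\<exists>m. elt i m \<in> H \<and> m k \<noteq> 0)"
  show thesis
  proof (cases "\<exists>k. ?Q k")
    case False
    have "H = tail i (len i)"
    proof
      show "H \<subseteq> tail i (len i)"
      proof
        fix x assume "x \<in> H"
        moreover then obtain m where "x = elt i m" using sub by auto
        ultimately show "x \<in> tail i (len i)" using False i by (auto simp: elt_in_tail)
      qed
      show "tail i (len i) \<subseteq> H" using zero i by (simp add: tail_full P_zero)
    qed
    then show thesis by (rule that[OF order_refl])
  next
    case True
    define k where "k = (LEAST k. ?Q k)"
    have Qk: "?Q k" unfolding k_def using True by (rule LeastI_ex)
    have least: "\<not> ?Q l" if "l < k" for l using that not_less_Least unfolding k_def by blast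
    obtain m where m: "elt i m \<in> H" "m k \<noteq> 0" using Qk by blast
    have low: "m' l = 0" if "elt i m' \<in> H" "l < k" for m' l
      using least[OF that(2)] that Qk by auto
    have "H = tail i k"
    proof
      show "H \<subseteq> tail i k"
      proof
        fix x assume "x \<in> H"
        moreover then obtain m' where "x = elt i m'" using sub by auto
        ultimately show "x \<in> tail i k" using low Qk i by (auto simp: elt_in_tail)
      qed
      have "tail i j \<subseteq> H" if "k \<le> j" "j \<le> len i" for j
        using that(2,1)
      proof (induction j rule: inc_induct)
        case base
        show ?case using zero i by (simp add: tail_full P_zero)
      next
        case (step j)
        show ?case
        proof
          fix x assume "x \<in> tail i j"
          then obtain t where t: "x = elt i t" "\<forall>l<j. t l = 0" by (auto simp: tail_def)
          \<comment> \<open>multiplying \<open>elt i m\<close> by this path moves its leading coefficient from \<open>k\<close> to \<open>j\<close> and scales it to \<open>t j\<close>\<close>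
          let ?r = "path_term ((i + k) mod n, j - k) (t j / m k) :: path \<Rightarrow> 'k"
          let ?s = "\<lambda>l. \<Sum>a\<le>l. m a * ?r ((i + a) mod n, l - a)"
          have rc: "?r \<in> carrier PA" using n_pos by (intro term_closed) simp
          then have "cls ?r \<odot>\<^bsub>P i\<^esub> elt i m \<in> H" using m(1) by (intro H.smult_closed) (auto simp: A_carrier)
          then have s: "elt i ?s \<in> H" by (simp only: P_smult[OF i rc])
          have sj: "?s j = t j"
          proof -
            have "?s j = (\<Sum>a\<le>j. if a = k then t j else 0)"
              using step.prems m(2) by (intro sum.cong) (auto simp: path_term_def)
            then show ?thesis using step.prems by simp
          qed
          have sl: "?s l = 0" if "l < j" for l
          proof (rule sum.neutral, rule ballI)
            fix a assume "a \<in> {..l}"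
            then show "m a * ?r ((i + a) mod n, l - a) = 0"
              using that low[OF m(1), of a] by (cases "a < k") (auto simp: path_term_def)
          qed
          have "elt i (\<lambda>l. t l - ?s l) \<in> tail i (Suc j)"
            using t(2) sj sl step.hyps i by (subst elt_in_tail) (auto simp: less_Suc_eq)
          then have "elt i (\<lambda>l. t l - ?s l) \<in> H" using step by auto
          from add[OF s this] show "x \<in> H" unfolding t(1) by simp
        qed
      qed
      then show "tail i k \<subseteq> H" using Qk by simp
    qed
    with Qk that[of k] show thesis by simp
  qed
qed

text \<open>
  A strict chain of submodules is a strictly monotone sequence of tails, indexed by \<open>{0..len i}\<close>.
\<close>

lemma P_length: "i < n \<Longrightarrow> module_length A (P i) = len i"
proof -
  assume i: "i < n"
  let ?L = "{l. \<exists>C :: nat \<Rightarrow> (path \<Rightarrow> 'k) set set. (\<forall>k\<le>l. submodule (C k) A (P i)) \<and> (\<forall>k<l. C k \<subset> C (Suc k))}"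
  have "len i \<in> ?L"
    using i tail_submodule tail_strict by (intro CollectI exI[of _ "\<lambda>k. tail i (len i - k)"]) auto
  moreover have "l \<le> len i" if l: "l \<in> ?L" for l
  proof -
    obtain C :: "nat \<Rightarrow> (path \<Rightarrow> 'k) set set" where C: "\<And>k. k \<le> l \<Longrightarrow> submodule (C k) A (P i)"
      "\<And>k. k < l \<Longrightarrow> C k \<subset> C (Suc k)" using l by blast
    have "\<exists>t\<le>len i. C k = tail i t" if "k \<le> l" for k
      using submodule_is_tail[OF i C(1)[OF that]] by blast
    then obtain t where t: "\<And>k. k \<le> l \<Longrightarrow> t k \<le> len i \<and> C k = tail i (t k)" by metis
    have dec: "t (Suc k) < t k" if "k < l" for k
    proof (rule ccontr)
      assume "\<not> t (Suc k) < t k"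
      then have "tail i (t (Suc k)) \<subseteq> tail i (t k)" unfolding tail_def by auto
      then show False using C(2)[OF that] t[of k] t[of "Suc k"] that by auto
    qed
    have "t k + k \<le> len i" if "k \<le> l" for k
      using that
    proof (induction k)
      case (Suc k)
      then show ?case using dec[of k] by simp
    qed (use t in auto)
    then show ?thesis by fastforce
  qed
  ultimately have "Sup ?L = len i"
    by (intro cSup_eq_maximum)
  then show ?thesis by (simp add: module_length_def)
qed

lemma P_simple_submodule:
  assumes i: "i < n"
  shows "simple_submodule A (P i) S \<longleftrightarrow> S = tail i (len i - 1)"
proof -
  have len: "0 < len i" using len_ge_2[of i] by simp
  show ?thesis
  proof
    assume S: "simple_submodule A (P i) S"
    then obtain k where k: "k \<le> len i" "S = tail i k"
      using submodule_is_tail[OF i, of S] unfolding simple_submodule_def by blast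
    have "k \<noteq> len i" using S k tail_full[OF i] by (auto simp: simple_submodule_def)
    then have "tail i (len i - 1) \<subseteq> S" unfolding k(2) tail_def using k(1) by auto
    moreover have "tail i (len i - 1) \<noteq> {\<zero>\<^bsub>P i\<^esub>}"
      using tail_strict[OF i, of "len i - 1" "len i"] len tail_full[OF i] by auto
    ultimately show "S = tail i (len i - 1)"
      using S tail_submodule[OF i] unfolding simple_submodule_def by blast
  next
    assume S: "S = tail i (len i - 1)"
    have "T = {\<zero>\<^bsub>P i\<^esub>} \<or> T = S" if T: "submodule T A (P i)" "T \<subseteq> S" for T
    proof -
      obtain k where k: "k \<le> len i" "T = tail i k" using submodule_is_tail[OF i T(1)] .
      have "\<not> k < len i - 1"
        using tail_strict[OF i, of k "len i - 1"] T(2) k S by auto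
      then have "k = len i - 1 \<or> k = len i" using k(1) by linarith
      then show ?thesis using k(2) S tail_full[OF i] by auto
    qed
    moreover have "S \<noteq> {\<zero>\<^bsub>P i\<^esub>}"
      using tail_strict[OF i, of "len i - 1" "len i"] len tail_full[OF i] S by auto
    ultimately show "simple_submodule A (P i) S"
      using tail_submodule[OF i] S unfolding simple_submodule_def by blast
  qed
qed

lemma P_socle: "i < n \<Longrightarrow> socle A (P i) = P i\<lparr>carrier := tail i (len i - 1)\<rparr>"
proof -
  assume i: "i < n"
  interpret P: abelian_group "P i" using i by (rule P_abelian_group)
  have sub: "subgroup (tail i (len i - 1)) (add_monoid (P i))"
    using tail_submodule[OF i] unfolding submodule_def by blast
  have "generate (add_monoid (P i)) (tail i (len i - 1)) = tail i (len i - 1)"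
  proof (rule equalityI)
    show "generate (add_monoid (P i)) (tail i (len i - 1)) \<subseteq> tail i (len i - 1)"
      by (rule P.add.generate_subgroup_incl[OF order_refl sub])
    show "tail i (len i - 1) \<subseteq> generate (add_monoid (P i)) (tail i (len i - 1))"
      by (rule subsetI) (rule generate.incl)
  qed
  moreover have "\<Union>{S. simple_submodule A (P i) S} = tail i (len i - 1)"
    using P_simple_submodule[OF i] by auto
  ultimately show ?thesis unfolding socle_def by simp
qed

text \<open>
  Trivial paths contain no relation, so the coefficient at a trivial path is constant on a residue class.
\<close>

lemma cls_value: "r \<in> carrier PA \<Longrightarrow> the_elem ((\<lambda>f. f (j, 0)) ` cls r) = r (j, 0)"
proof -
  assume r: "r \<in> carrier PA"
  have "f (j, 0) = r (j, 0)" if f: "f \<in> cls r" for f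
  proof -
    obtain h where h: "h \<in> I" "f = h \<oplus>\<^bsub>PA\<^esub> r"
      using f unfolding cls_def a_r_coset_def r_coset_def by auto
    have "\<not> dead j 0" using len_ge_2[of j] by (simp add: dead_iff)
    with h(1) have "h (j, 0) = 0" unfolding relation_ideal_eq dead_span_def by auto
    with h(2) show ?thesis by (simp add: PA_simps)
  qed
  then have "(\<lambda>f. f (j, 0)) ` cls r = (\<lambda>_. r (j, 0)) ` cls r"
    by (intro image_cong refl)
  moreover have "r \<in> cls r" unfolding cls_def using I.a_rcos_self[OF r] .
  ultimately have "(\<lambda>f. f (j, 0)) ` cls r = {r (j, 0)}" by (simp only: image_constant)
  then show ?thesis by simp
qed

text \<open>
  The socle is spanned by the longest surviving path from \<open>i\<close>, which ends at vertex \<open>i + len i - 1\<close>.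
  The idempotent of this vertex acts as the identity on the socle, but as zero on the simple module of any other vertex.
\<close>

lemma socle_iso_simple:
  assumes i: "i < n" and j: "j < n"
  shows "module_iso A (socle A (P i)) (simple_module K j) \<longleftrightarrow> j = (i + len i - 1) mod n"
proof -
  let ?L = "len i - 1" and ?s = "(i + len i - 1) mod n"
  have len: "?L < len i" "i + len i - 1 = i + ?L" using len_ge_2[of i] by simp_all
  define b where "b c = elt i (\<lambda>l. if l = ?L then c else 0)" for c :: 'k
  have carrier: "tail i ?L = range b"
  proof (intro equalityI subsetI)
    fix x assume "x \<in> tail i ?L"
    then obtain m where "x = elt i m" "\<forall>l<?L. m l = 0" by (auto simp: tail_def)
    then have "x = b (m ?L)" unfolding b_def using i by (auto simp: elt_eq_iff)
    then show "x \<in> range b" by blast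
  qed (auto simp: b_def tail_def)
  have inj: "inj b" unfolding b_def using i len by (auto simp: inj_def elt_eq_iff)
  have badd: "b c \<oplus>\<^bsub>P i\<^esub> b d = b (c + d)" for c d
    unfolding b_def P_add[OF i] using i by (simp add: elt_eq_iff)
  have bsmult: "cls r \<odot>\<^bsub>P i\<^esub> b c = b (c * r (?s, 0))" if "r \<in> carrier PA" for r c
  proof -
    have "(\<Sum>k\<le>l. (if k = ?L then c else 0) * r ((i + k) mod n, l - k)) =
        (if l = ?L then c * r (?s, 0) else 0)" if "l < len i" for l
    proof -
      have "(\<Sum>k\<le>l. (if k = ?L then c else 0) * r ((i + k) mod n, l - k)) =
          (\<Sum>k\<le>l. if k = ?L then c * r ((i + ?L) mod n, l - ?L) else 0)" by (intro sum.cong) auto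
      then show ?thesis using that len by auto
    qed
    then show ?thesis unfolding b_def P_smult[OF i that] using i by (simp add: elt_eq_iff)
  qed
  show ?thesis
  proof
    assume eq: "j = ?s"
    let ?h = "the_inv b"
    have h: "?h (b c) = c" for c using inj by (rule the_inv_f_f)
    show "module_iso A (socle A (P i)) (simple_module K j)"
      unfolding module_iso_def P_socle[OF i]
    proof (intro exI[of _ ?h] conjI ballI)
      show "bij_betw ?h (carrier (P i\<lparr>carrier := tail i ?L\<rparr>)) (carrier (simple_module K j))"
        unfolding bij_betw_def carrier simple_module_def
        using h by (auto simp: inj_on_def image_iff intro!: exI)
      fix x y assume "x \<in> carrier (P i\<lparr>carrier := tail i ?L\<rparr>)" "y \<in> carrier (P i\<lparr>carrier := tail i ?L\<rparr>)"
      then have "x \<in> range b" "y \<in> range b" unfolding carrier[symmetric] by simp_all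
      then show "?h (x \<oplus>\<^bsub>P i\<lparr>carrier := tail i ?L\<rparr>\<^esub> y) = ?h x \<oplus>\<^bsub>simple_module K j\<^esub> ?h y"
        by (auto simp: h badd simple_module_def)
    next
      fix r x assume r: "r \<in> carrier A" and "x \<in> carrier (P i\<lparr>carrier := tail i ?L\<rparr>)"
      then have "x \<in> range b" unfolding carrier[symmetric] by simp
      with r have "r \<in> carrier A" "x \<in> range b" by simp_all
      then show "?h (r \<odot>\<^bsub>P i\<lparr>carrier := tail i ?L\<rparr>\<^esub> x) = r \<odot>\<^bsub>simple_module K j\<^esub> ?h x"
        by (auto simp: A_carrier h bsmult simple_module_def cls_value eq)
    qed
  next
    assume "module_iso A (socle A (P i)) (simple_module K j)"
    then obtain h where h: "bij_betw h (tail i ?L) UNIV"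
      "\<And>r x. r \<in> carrier A \<Longrightarrow> x \<in> tail i ?L \<Longrightarrow>
        h (r \<odot>\<^bsub>P i\<^esub> x) = h x * the_elem ((\<lambda>f. f (j, 0)) ` r)"
      unfolding module_iso_def P_socle[OF i] by (auto simp: simple_module_def)
    let ?r = "path_term (?s, 0) 1 :: path \<Rightarrow> 'k"
    have r: "?r \<in> carrier PA" using n_pos by (intro term_closed) simp
    obtain x where x: "x \<in> tail i ?L" "h x = 1"
      using h(1) unfolding bij_betw_def by (metis UNIV_I imageE)
    obtain c where c: "x = b c" using x(1) unfolding carrier by blast
    have "cls ?r \<odot>\<^bsub>P i\<^esub> x = x" unfolding c bsmult[OF r] by (simp add: path_term_def)
    then have "h x = h x * ?r (j, 0)"
      using h(2)[of "cls ?r" x] x(1) r by (simp add: A_carrier cls_value)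
    then show "j = ?s" using x(2) by (auto simp: path_term_def split: if_splits)
  qed
qed

end

section \<open>From relations to a periodic map\<close>

lemma path_word_append:
  "path_word n (a, k + m) = path_word n (a, k) @ path_word n ((a + k) mod n, m)"
proof -
  have "map (\<lambda>j. (a + j) mod n) [k..<k + m] = map (\<lambda>j. ((a + k) mod n + j) mod n) [0..<m]"
    by (rule nth_equalityI) (simp_all add: mod_add_left_eq add.assoc)
  then show ?thesis
    unfolding path_word_def by (simp add: upt_add_eq_append[of 0 k m, simplified] del: upt_Suc)
qed

lemma subwordI: "k + l' \<le> l \<Longrightarrow> subword n ((a + k) mod n, l') (a, l)"
proof -
  assume "k + l' \<le> l"
  then have "path_word n (a, l) = path_word n (a, k + (l' + (l - k - l')))" by simp
  then show ?thesis unfolding subword_def path_word_append by simp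
qed

lemma sublist_pair_iff: "sublist [u, v] xs \<longleftrightarrow> (\<exists>j. Suc j < length xs \<and> xs ! j = u \<and> xs ! Suc j = v)"
proof
  assume "sublist [u, v] xs"
  then obtain ps ss where xs: "xs = ps @ [u, v] @ ss" by (auto simp: sublist_def)
  show "\<exists>j. Suc j < length xs \<and> xs ! j = u \<and> xs ! Suc j = v"
    by (rule exI[of _ "length ps"]) (simp add: xs nth_append)
next
  assume "\<exists>j. Suc j < length xs \<and> xs ! j = u \<and> xs ! Suc j = v"
  then obtain j where j: "Suc j < length xs" "xs ! j = u" "xs ! Suc j = v" by blast
  then have "xs = take j xs @ [u, v] @ drop (Suc (Suc j)) xs"
    by (metis Cons_nth_drop_Suc Suc_lessD append_Cons append_Nil append_take_drop_id)
  then show "sublist [u, v] xs" unfolding sublist_def by blast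
qed

text \<open>
  An internal vertex is the residue of an interior point of the interval of the relation. The number \<open>k\<close>
  counts the turns of the path before it meets the vertex.
\<close>

lemma internal_vertices_iff:
  assumes n: "0 < n" and a: "a < n"
  shows "v \<in> internal_vertices n (a, l) \<longleftrightarrow> v < n \<and> (\<exists>k. a < v + k * n \<and> v + k * n < a + l)"
proof -
  have prev: "(a + j) mod n = (v + n - 1) mod n" if "(a + Suc j) mod n = v" for j
  proof -
    have "v + n - 1 = v + (n - 1)" using n by simp
    also have "(v + (n - 1)) mod n = (a + Suc j + (n - 1)) mod n"
      unfolding that[symmetric] by (rule mod_add_left_eq)
    also have "a + Suc j + (n - 1) = a + j + n" using n by simp
    finally show ?thesis by simp
  qed
  have "v \<in> internal_vertices n (a, l) \<longleftrightarrow> v < n \<and> (\<exists>j. Suc j < l \<and> (a + Suc j) mod n = v)"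
    unfolding internal_vertices_def sublist_pair_iff path_word_def using prev by auto
  also have "\<dots> \<longleftrightarrow> v < n \<and> (\<exists>k. a < v + k * n \<and> v + k * n < a + l)"
  proof (intro conj_cong refl iffI)
    assume "\<exists>j. Suc j < l \<and> (a + Suc j) mod n = v"
    then obtain j where j: "Suc j < l" "(a + Suc j) mod n = v" by blast
    have "v + (a + Suc j) div n * n = a + Suc j" unfolding j(2)[symmetric] by simp
    with j(1) show "\<exists>k. a < v + k * n \<and> v + k * n < a + l" by (intro exI[of _ "(a + Suc j) div n"]) simp
  next
    assume v: "v < n" and "\<exists>k. a < v + k * n \<and> v + k * n < a + l"
    then obtain k where k: "a < v + k * n" "v + k * n < a + l" by blast
    define j where "j = v + k * n - Suc a"
    have "a + Suc j = v + k * n" unfolding j_def using k(1) by simp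
    then have "Suc j < l" "(a + Suc j) mod n = v" using k(2) v by simp_all
    then show "\<exists>j. Suc j < l \<and> (a + Suc j) mod n = v" by blast
  qed
  finally show ?thesis .
qed

context nakayama
begin

text \<open>
  The endpoint on the line, not reduced modulo \<open>n\<close>, of the shortest vanishing path from \<open>v\<close>. This is the
  map whose residues form the resolution quiver.
\<close>

definition path_end :: "nat \<Rightarrow> nat" where
  "path_end v = v + len v"

lemma dead_mod: "dead (i mod n) L = dead i L"
  unfolding dead_def by (simp add: mod_add_left_eq)

text \<open>
  With \<open>(x mod n, l)\<close> read as the interval from \<open>x\<close> to \<open>x + l\<close>, no residues are left on the right but
  the one in the membership. Monotonicity and the position of the jumps follow from this description.
\<close>

lemma path_end_le_iff:
  "path_end v \<le> e \<longleftrightarrow> (\<exists>x l. (x mod n, l) \<in> Y \<and> v \<le> x \<and> x + l \<le> e)"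
proof (cases "v \<le> e")
  case True
  then have "path_end v \<le> e \<longleftrightarrow> dead v (e - v)" unfolding path_end_def dead_iff by linarith
  also have "\<dots> \<longleftrightarrow> (\<exists>x l. (x mod n, l) \<in> Y \<and> v \<le> x \<and> x + l \<le> e)"
  proof
    assume "dead v (e - v)"
    then obtain l k where "((v + k) mod n, l) \<in> Y" "k + l \<le> e - v" unfolding dead_def by blast
    with True show "\<exists>x l. (x mod n, l) \<in> Y \<and> v \<le> x \<and> x + l \<le> e"
      by (intro exI[of _ "v + k"] exI[of _ l]) simp
  next
    assume "\<exists>x l. (x mod n, l) \<in> Y \<and> v \<le> x \<and> x + l \<le> e"
    then obtain x l where "(x mod n, l) \<in> Y" "v \<le> x" "x + l \<le> e" by blast
    then show "dead v (e - v)" unfolding dead_def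
      by (intro exI[of _ "x mod n"] exI[of _ l] exI[of _ "x - v"]) simp
  qed
  finally show ?thesis .
qed (auto simp: path_end_def)

end

sublocale nakayama \<subseteq> R: periodic_map path_end n
proof
  show "0 < n" by (rule n_pos)
  show "mono path_end"
  proof (rule monoI)
    fix v w :: nat assume "v \<le> w"
    moreover obtain x l where "(x mod n, l) \<in> Y" "w \<le> x" "x + l \<le> path_end w"
      using path_end_le_iff[of w "path_end w"] by blast
    ultimately show "path_end v \<le> path_end w" unfolding path_end_le_iff[of v] by (meson le_trans)
  qed
  fix v
  have "dead (v + n) = dead v"
    by (rule ext) (metis dead_mod mod_add_self2)
  then have "len (v + n) = len v" by (simp add: len_def)
  then show "path_end (v + n) = path_end v + n" by (simp add: path_end_def)
  show "v < path_end v" using len_ge_2[of v] by (simp add: path_end_def)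
qed

context nakayama
begin

lemma relation_irredundant:
  assumes "(a, l) \<in> Y" "((a + k) mod n, l') \<in> Y" "k + l' \<le> l"
  shows "l' = l"
  using assms subwordI[OF assms(3), of n a] relations
  unfolding cyclic_nakayama_relations_def nakayama_relations_def by blast

text \<open>
  An interval inside another one is a subword, so by irredundancy no other relation starts at or after \<open>v\<close>
  and ends by \<open>v + l\<close>.
\<close>

lemma relation_end:
  assumes y: "(v mod n, l) \<in> Y"
  shows "path_end v = v + l" and "path_end v < path_end (Suc v)"
proof -
  have no: "x + l' < v + l \<Longrightarrow> False" and no_later: "v < x \<Longrightarrow> x + l' \<le> v + l \<Longrightarrow> False"
    if x: "(x mod n, l') \<in> Y" "v \<le> x" for x l'
  proof -
    have "(v mod n + (x - v)) mod n = (v + (x - v)) mod n" by (rule mod_add_left_eq)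
    then have "((v mod n + (x - v)) mod n, l') \<in> Y" using x by simp
    then have *: "l' = l" if "x + l' \<le> v + l"
      using relation_irredundant[OF y, of "x - v" l'] that x(2) by simp
    show False if "x + l' < v + l" using * that x(2) by simp
    show False if "v < x" "x + l' \<le> v + l" using * that by simp
  qed
  show end_eq: "path_end v = v + l"
  proof (rule antisym)
    show "path_end v \<le> v + l" unfolding path_end_le_iff using y by blast
    obtain x l' where "(x mod n, l') \<in> Y" "v \<le> x" "x + l' \<le> path_end v"
      using path_end_le_iff[of v "path_end v"] by blast
    then show "v + l \<le> path_end v" using no[of x l'] by (meson le_trans not_le)
  qed
  have "\<not> path_end (Suc v) \<le> v + l"
    unfolding path_end_le_iff using no_later by (metis Suc_le_eq less_imp_le)
  then show "path_end v < path_end (Suc v)" unfolding end_eq by simp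
qed

lemma jumps_iff: "v \<in> R.jumps \<longleftrightarrow> (\<exists>l. (v mod n, l) \<in> Y)"
proof
  assume "v \<in> R.jumps"
  then have less: "path_end v < path_end (Suc v)" by (simp add: R.jumps_def)
  obtain x l where x: "(x mod n, l) \<in> Y" "v \<le> x" "x + l \<le> path_end v"
    using path_end_le_iff[of v "path_end v"] by blast
  have "\<not> Suc v \<le> x" using x less path_end_le_iff[of "Suc v" "path_end v"] by (meson leD)
  with x have "x = v" by simp
  with x show "\<exists>l. (v mod n, l) \<in> Y" by blast
qed (use relation_end R.jumps_def in blast)

lemma starts_eq: "R.starts = fst ` Y"
proof (intro equalityI subsetI)
  fix v assume "v \<in> R.starts"
  then show "v \<in> fst ` Y" by (auto simp: R.starts_def jumps_iff intro: rev_image_eqI)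
next
  fix v assume "v \<in> fst ` Y"
  then obtain l where y: "(v, l) \<in> Y" by auto
  then have "v < n" by (rule relation_start)
  with y show "v \<in> R.starts" by (auto simp: R.starts_def jumps_iff)
qed

lemma path_end_relation: "(a, l) \<in> Y \<Longrightarrow> path_end a = a + l"
  using relation_end(1)[of a l] relation_start[of a l] by simp

lemma inj_on_fst: "inj_on fst Y"
proof (rule inj_onI)
  fix y z assume yz: "y \<in> Y" "z \<in> Y" "fst y = fst z"
  have "path_end (fst w) = fst w + snd w" if "w \<in> Y" for w
    using path_end_relation[of "fst w" "snd w"] that by simp
  from this[OF yz(1)] this[OF yz(2)] yz(3) show "y = z" by (simp add: prod_eq_iff)
qed

lemma covers_iff: "\<sigma> \<subseteq> Y \<Longrightarrow> R.covers (fst ` \<sigma>) \<longleftrightarrow> (\<Union>y\<in>\<sigma>. internal_vertices n y) = {..<n}"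
proof -
  assume sub: "\<sigma> \<subseteq> Y"
  have iff: "v \<in> internal_vertices n y \<longleftrightarrow>
      v < n \<and> (\<exists>k. fst y < v + k * n \<and> v + k * n < path_end (fst y))" if "y \<in> \<sigma>" for v y
  proof -
    have y: "(fst y, snd y) \<in> Y" using that sub by auto
    show ?thesis
      using internal_vertices_iff[OF n_pos relation_start[OF y], of v "snd y"] path_end_relation[OF y] by simp
  qed
  show ?thesis
  proof
    assume cov: "R.covers (fst ` \<sigma>)"
    show "(\<Union>y\<in>\<sigma>. internal_vertices n y) = {..<n}"
    proof (intro equalityI subsetI)
      fix v assume "v \<in> (\<Union>y\<in>\<sigma>. internal_vertices n y)"
      then show "v \<in> {..<n}" using iff by blast
    next
      fix v assume v: "v \<in> {..<n}"
      then obtain y k where "y \<in> \<sigma>" "fst y < v + k * n" "v + k * n < path_end (fst y)"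
        using cov unfolding R.covers_def by blast
      with v iff[of y v] show "v \<in> (\<Union>y\<in>\<sigma>. internal_vertices n y)" by blast
    qed
  next
    assume eq: "(\<Union>y\<in>\<sigma>. internal_vertices n y) = {..<n}"
    show "R.covers (fst ` \<sigma>)"
      unfolding R.covers_def
    proof (intro allI impI)
      fix v assume "v < n"
      then obtain y where "y \<in> \<sigma>" "v \<in> internal_vertices n y" using eq by blast
      then show "\<exists>a\<in>fst ` \<sigma>. \<exists>k. a < v + k * n \<and> v + k * n < path_end a" using iff by blast
    qed
  qed
qed

lemma long_relation_covers: "y \<in> Y \<Longrightarrow> n < snd y \<Longrightarrow> internal_vertices n y = {..<n}"
proof -
  assume y: "y \<in> Y" "n < snd y"
  obtain a l where al: "y = (a, l)" by (cases y)
  have a: "a < n" using y relation_start al by blast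
  have "\<exists>k. a < v + k * n \<and> v + k * n < a + l" if "v < n" for v
  proof (cases "a < v")
    case True
    with y al that show ?thesis by (intro exI[of _ 0]) simp
  next
    case False
    with y al a show ?thesis by (intro exI[of _ 1]) simp
  qed
  then show ?thesis using internal_vertices_iff[OF n_pos a] al by auto
qed

text \<open>
  A relation longer than \<open>n\<close> covers all vertices and so belongs to no noncovering set, which accounts
  for the bound on the length.
\<close>

lemma relation_complex_eq:
  "relation_complex n Y = {\<sigma>. \<sigma> \<subseteq> Y \<and> \<sigma> \<noteq> {} \<and> \<not> R.covers (fst ` \<sigma>)}"
proof -
  have short: "snd y \<le> n" if "\<sigma> \<subseteq> Y" "y \<in> \<sigma>" "\<not> R.covers (fst ` \<sigma>)" for \<sigma> y
  proof (rule ccontr)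
    assume "\<not> snd y \<le> n"
    then have "internal_vertices n y = {..<n}" using that by (intro long_relation_covers) auto
    moreover have "internal_vertices n z \<subseteq> {..<n}" for z by (auto simp: internal_vertices_def)
    ultimately have "(\<Union>y\<in>\<sigma>. internal_vertices n y) = {..<n}" using that(2) by blast
    with that show False using covers_iff by blast
  qed
  show ?thesis
  proof (intro equalityI subsetI)
    fix \<sigma> assume "\<sigma> \<in> relation_complex n Y"
    then have "\<sigma> \<subseteq> Y" "\<sigma> \<noteq> {}" "(\<Union>y\<in>\<sigma>. internal_vertices n y) \<noteq> {..<n}"
      unfolding relation_complex_def by auto
    then show "\<sigma> \<in> {\<sigma>. \<sigma> \<subseteq> Y \<and> \<sigma> \<noteq> {} \<and> \<not> R.covers (fst ` \<sigma>)}" by (simp add: covers_iff)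
  next
    fix \<sigma> assume "\<sigma> \<in> {\<sigma>. \<sigma> \<subseteq> Y \<and> \<sigma> \<noteq> {} \<and> \<not> R.covers (fst ` \<sigma>)}"
    then have \<sigma>: "\<sigma> \<subseteq> Y" "\<sigma> \<noteq> {}" "\<not> R.covers (fst ` \<sigma>)" by simp_all
    have "\<sigma> \<subseteq> {y \<in> Y. snd y \<le> n}" using \<sigma>(1) short[OF \<sigma>(1) _ \<sigma>(3)] by blast
    with \<sigma> show "\<sigma> \<in> relation_complex n Y" by (simp add: relation_complex_def covers_iff)
  qed
qed

lemma euler_characteristic_eq: "euler_characteristic (relation_complex n Y) = int (card R.crossings)"
proof -
  let ?S = "{S. S \<subseteq> R.starts \<and> S \<noteq> {} \<and> \<not> R.covers S}"
  have "?S = (`) fst ` relation_complex n Y"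
  proof (intro equalityI subsetI)
    fix S assume S: "S \<in> ?S"
    then obtain \<sigma> where "\<sigma> \<subseteq> Y" "S = fst ` \<sigma>" unfolding starts_eq by (auto simp: subset_image_iff)
    with S show "S \<in> (`) fst ` relation_complex n Y" unfolding relation_complex_eq by blast
  qed (auto simp: relation_complex_eq starts_eq)
  moreover have "inj_on ((`) fst) (relation_complex n Y)"
    by (rule inj_on_subset[OF inj_on_image_Pow[OF inj_on_fst]]) (auto simp: relation_complex_eq)
  moreover have "card (fst ` \<sigma>) = card \<sigma>" if "\<sigma> \<in> relation_complex n Y" for \<sigma>
    using that inj_on_subset[OF inj_on_fst] by (intro card_image) (simp add: relation_complex_eq)
  ultimately have "(\<Sum>S\<in>?S. (- 1) ^ (card S - 1)) = (\<Sum>\<sigma>\<in>relation_complex n Y. (- 1) ^ (card \<sigma> - 1) :: int)"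
    by (intro sum.reindex_cong) auto
  then show ?thesis using R.noncovering_sum by (simp add: euler_characteristic_def)
qed

lemma proj_length_eq: "i < n \<Longrightarrow> proj_length K n Y i = path_end i - i"
  unfolding proj_length_def path_end_def using P_length by simp

lemma Suc_mod_iff: "Suc x mod n = Suc y mod n \<longleftrightarrow> x mod n = y mod n"
proof
  assume "Suc x mod n = Suc y mod n"
  then have "(Suc x + (n - 1)) mod n = (Suc y + (n - 1)) mod n" by (rule mod_add_cong) (rule refl)
  moreover have "Suc z + (n - 1) = z + n" for z using n_pos by simp
  ultimately show "x mod n = y mod n" by (simp only: mod_add_self2)
next
  assume "x mod n = y mod n"
  then have "Suc (x mod n) mod n = Suc (y mod n) mod n" by (rule arg_cong)
  then show "Suc x mod n = Suc y mod n" by (simp only: mod_Suc_eq)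
qed

lemma resolution_arrows_eq: "resolution_arrows K n Y = R.arrows"
proof -
  have "(j + n - 1) mod n = (i + len i - 1) mod n \<longleftrightarrow> j = R.step i" if "j < n" for i j
  proof -
    have "(j + n - 1) mod n = (i + len i - 1) mod n \<longleftrightarrow>
        Suc (j + n - 1) mod n = Suc (i + len i - 1) mod n"
      by (rule Suc_mod_iff[symmetric])
    also have "Suc (j + n - 1) = j + n" using n_pos by simp
    also have "Suc (i + len i - 1) = i + len i" using len_ge_2[of i] by simp
    finally show ?thesis using that by (auto simp: R.step_def path_end_def)
  qed
  then show ?thesis
    unfolding resolution_arrows_def R.arrows_def Let_def
    using socle_iso_simple n_pos R.step_less by (auto simp del: One_nat_def)
qed

lemma cycle_weight_eq:
  assumes "oriented_cycle R.arrows c"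
  shows "cycle_weight K n Y c = (\<Sum>i\<leftarrow>c. of_nat (path_end i - i)) / of_nat n"
proof -
  have "i < n" if "i \<in> set c" for i
    using assms that by (auto simp: oriented_cycle_def R.arrows_def in_set_conv_nth)
  then have "map (\<lambda>i. of_nat (proj_length K n Y i) :: rat) c = map (\<lambda>i. of_nat (path_end i - i)) c"
    by (simp add: proj_length_eq)
  then show ?thesis unfolding cycle_weight_def by (simp only:)
qed

lemma euler_characteristic_relation_complex:
  "euler_characteristic (relation_complex n Y) =
    int (card {C \<in> quiver_components {..<n} (resolution_arrows K n Y). component_weight K n Y C = 1})"
  unfolding euler_characteristic_eq component_weight_def resolution_arrows_eq
  using R.card_weight_one_components[of "cycle_weight K n Y", OF cycle_weight_eq] by simp

end

section \<open>Euler characteristic of the relation complex\<close>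

theorem theoremC:
  fixes n :: nat and Y :: "path set"
  assumes "cyclic_nakayama_relations n Y"
  shows "euler_characteristic (relation_complex n Y) =
         int (card {C \<in> quiver_components {..<n} (resolution_arrows TYPE('k::field) n Y).
                      component_weight TYPE('k) n Y C = 1})"
proof -
  interpret nakayama "TYPE('k)" n Y using assms by unfold_locales
  show ?thesis by (rule euler_characteristic_relation_complex)
qed

end
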